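(* For every integer $n\ge 3$, the cycle $C_n$ on $n$ vertices satisfies $$\operatorname{ML-degree}(C_n)\ \ge\ 1+(n-3)\cdot 2^{n-2}.$$
   Context: Let $G=(V,E)$ be a finite simple undirected graph with $n$ vertices $V=[n]=\{1,\dots,n\}$. Let $S^2(\mathbb{C}^n)$ be the space of complex symmetric $n\times n$ matrices. $L_G\subset S^2(\mathbb{C}^n)$ is the linear space of symmetric matrices $M$ with $M_{ij}=0$ whenever $i\neq j$ and $\{i,j\}\notin E$. $L_G^{-1}$ is the closure in $S^2(\mathbb{C}^n)$ of the set of inverses of invertible matrices in $L_G$. $L_G^{\perp}$ is the orthogonal complement of $L_G$ with respect to the bilinear trace form, i.e. the symmetric matrices that vanish on the diagonal and at all positions $(i,j)$ with $\{i,j\}\in E$. The ML-degree of $G$ is the number of points of $(S+L_G^{\perp})\cap L_G^{-1}$ for a generic symmetric matrix $S\in S^2(\mathbb{C}^n)$ (this number does not depend on the generic choice of $S$). $C_n$ denotes the cycle graph with $n$ vertices. *)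

theory Defs
  imports "HOL-Analysis.Analysis"
begin

text \<open>
  The vertex set is the finite type \<open>'n\<close>, so that the number of vertices is \<open>CARD('n)\<close>;
  a graph is given by its edge set, consisting of two-element sets \<open>{i, j}\<close>.
\<close>

definition sym_mats :: "(complex ^ 'n ^ 'n) set" where
  "sym_mats = {M. transpose M = M}"

definition graph_space :: "'n set set \<Rightarrow> (complex ^ 'n ^ 'n) set" where
  "graph_space E = {M \<in> sym_mats. \<forall>i j. i \<noteq> j \<and> {i, j} \<notin> E \<longrightarrow> M $ i $ j = 0}"

text \<open>
  The closure is the Euclidean one. The set of symmetric matrices is closed, so it does not matter
  that the closure is taken among all matrices. The set of inverses is the image of a Zariski-open
  set under a rational map, hence constructible, so this is also its Zariski closure.
\<close>

definition graph_space_inv :: "'n::finite set set \<Rightarrow> (complex ^ 'n ^ 'n) set" where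
  "graph_space_inv E = closure (matrix_inv ` {M \<in> graph_space E. invertible M})"

definition graph_space_perp :: "'n::finite set set \<Rightarrow> (complex ^ 'n ^ 'n) set" where
  "graph_space_perp E = {A \<in> sym_mats. \<forall>M \<in> graph_space E. trace (A ** M) = 0}"

text \<open>Functions given by polynomials in the matrix entries.\<close>

inductive entry_polynomial :: "(complex ^ 'n ^ 'n \<Rightarrow> complex) \<Rightarrow> bool" where
  const: "entry_polynomial (\<lambda>M. c)"
| entry: "entry_polynomial (\<lambda>M. M $ i $ j)"
| add: "entry_polynomial p \<Longrightarrow> entry_polynomial q \<Longrightarrow> entry_polynomial (\<lambda>M. p M + q M)"
| mult: "entry_polynomial p \<Longrightarrow> entry_polynomial q \<Longrightarrow> entry_polynomial (\<lambda>M. p M * q M)"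

text \<open>
  A property holds for generic symmetric matrices if it holds on a nonempty Zariski-open subset of
  the space of symmetric matrices. Such a subset always contains a nonempty one of the form
  \<open>p \<noteq> 0\<close>, so a single polynomial suffices.
\<close>

definition for_generic_sym :: "(complex ^ 'n ^ 'n \<Rightarrow> bool) \<Rightarrow> bool" where
  "for_generic_sym P \<longleftrightarrow>
     (\<exists>p. entry_polynomial p \<and> (\<exists>S \<in> sym_mats. p S \<noteq> 0) \<and>
          (\<forall>S \<in> sym_mats. p S \<noteq> 0 \<longrightarrow> P S))"

definition ml_fibre :: "'n::finite set set \<Rightarrow> complex ^ 'n ^ 'n \<Rightarrow> (complex ^ 'n ^ 'n) set" where
  "ml_fibre E S = {S + A | A. A \<in> graph_space_perp E} \<inter> graph_space_inv E"

text \<open>Finiteness is required explicitly because infinite sets have \<open>card\<close> equal to 0.\<close>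

definition ml_degree :: "'n::finite set set \<Rightarrow> nat" where
  "ml_degree E = (THE d. for_generic_sym (\<lambda>S. finite (ml_fibre E S) \<and> card (ml_fibre E S) = d))"

text \<open>
  \<open>v\<close> runs once around the cycle. With fewer than three vertices the edge set would contain
  a singleton or consist of a single edge, so this is only meaningful for \<open>CARD('n) \<ge> 3\<close>.
\<close>

definition is_cycle_graph :: "'n::finite set set \<Rightarrow> bool" where
  "is_cycle_graph E \<longleftrightarrow>
     (\<exists>v :: nat \<Rightarrow> 'n. bij_betw v {..<CARD('n)} UNIV \<and>
        E = {{v i, v (Suc i mod CARD('n))} | i. i < CARD('n)})"

end

(*
  Existence of the ML-degree. Inversion followed by projection to L_G extends to a rational self-map F
  of the space of all matrices. Counting monomials shows that every rational function h satisfies a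
  polynomial equation whose coefficients are polynomials in F. Applied to the coordinates and to the
  reciprocal of the denominator this gives properness of F over the complement of a hypersurface;
  applied to the Jacobian determinant it gives that F is a local homeomorphism there. Hence the number
  of preimages is locally constant on this complement, which is connected since complex lines meet
  the hypersurface in finitely many points.

  Lower bound. Every nondegenerate solution for one particular S persists for S nearby, so it suffices to
  exhibit enough solutions for S = 1. One is the identity matrix. The others are limits of covariance
  matrices: the Green function of a periodic tridiagonal matrix is expressed through the quotients
  t_1, ..., t_n of consecutive values of a Floquet solution, with multiplier r = t_1 ... t_n, and the
  normalised edge entries are (t_i + r / t_i) / (1 + r). If these all vanish, then t_i^2 = -r for all i,
  which has (n - 3) * 2^(n - 2) solutions with r /= -1 up to t -> 1/t, and there the map from t to the edge entries
  is a local homeomorphism.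
*)

theory Submission
  imports Defs
begin

section \<open>Polynomials in the matrix entries\<close>

text \<open>The fibre is taken in a closure, so it may contain limits of inverses that are not
  inverses. For generic S this does not happen: the concentration matrices approaching such a limit
  extend to preimages under F of points with a common limit, properness bounds them, and the limit
  of a subsequence inverts the limit point. For S = 1 it does happen: r = 1 occurs among the
  exhibited solutions when n is even, and the covariance matrix then has rank at most 2. So the
  solutions are not deformed through F but through scalings d and quotients t, in which such points
  are regular. The size of the fibre over S = 1 itself is never determined, since 1 may lie on the
  excluded hypersurface. Only fibre points over nearby symmetric S are produced, and some of these S
  are generic. The factor n - 3: the equations t_i^2 = -r have (n - 2) * 2^(n - 1) solutions with
  nonzero entries, and r = -1 removes 2^(n - 1) of them because 1 + r is a denominator. The
  involution t -> 1/t acts freely on the rest and halves their number.\<close>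

lemma entry_polynomial_uminus: "entry_polynomial p \<Longrightarrow> entry_polynomial (\<lambda>M. - p M)"
  using entry_polynomial.mult[OF entry_polynomial.const[of "-1"]] by fastforce

lemma entry_polynomial_diff:
  "entry_polynomial p \<Longrightarrow> entry_polynomial q \<Longrightarrow> entry_polynomial (\<lambda>M. p M - q M)"
  using entry_polynomial.add[OF _ entry_polynomial_uminus] by fastforce

lemma entry_polynomial_sum:
  "(\<And>i. i \<in> I \<Longrightarrow> entry_polynomial (p i)) \<Longrightarrow> entry_polynomial (\<lambda>M. \<Sum>i\<in>I. p i M)"
  by (induction I rule: infinite_finite_induct) (auto intro: entry_polynomial.intros)

lemma entry_polynomial_prod:
  "(\<And>i. i \<in> I \<Longrightarrow> entry_polynomial (p i)) \<Longrightarrow> entry_polynomial (\<lambda>M. \<Prod>i\<in>I. p i M)"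
  by (induction I rule: infinite_finite_induct) (auto intro: entry_polynomial.intros)

lemma entry_polynomial_power: "entry_polynomial p \<Longrightarrow> entry_polynomial (\<lambda>M. p M ^ k)"
  by (induction k) (auto intro: entry_polynomial.intros)

lemma entry_polynomial_if:
  "(P \<Longrightarrow> entry_polynomial p) \<Longrightarrow> (\<not> P \<Longrightarrow> entry_polynomial q) \<Longrightarrow>
    entry_polynomial (\<lambda>M. if P then p M else q M)"
  by (cases P) auto

lemma entry_polynomial_det:
  fixes A :: "complex ^ 'n ^ 'n \<Rightarrow> complex ^ 'k ^ 'k"
  assumes "\<And>i j. entry_polynomial (\<lambda>M. A M $ i $ j)"
  shows "entry_polynomial (\<lambda>M. det (A M))"
  unfolding det_def
  by (intro entry_polynomial_sum entry_polynomial.mult entry_polynomial.const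
      entry_polynomial_prod assms)

lemmas entry_polynomial_intros = entry_polynomial.intros entry_polynomial_uminus
  entry_polynomial_diff entry_polynomial_sum entry_polynomial_prod entry_polynomial_power
  entry_polynomial_if entry_polynomial_det

lemma has_derivative_entry: "((\<lambda>M. M $ i $ j) has_derivative (\<lambda>h. h $ i $ j)) F"
  using bounded_linear.has_derivative[OF bounded_linear_vec_nth
      bounded_linear.has_derivative[OF bounded_linear_vec_nth has_derivative_ident]] .

text \<open>For the Jacobian determinant of a rational map to enter an algebraic relation, the
  partial derivatives must again be polynomials in the entries; each induction step supplies a
  formula for them.\<close>

lemma entry_polynomial_has_derivative:
  fixes p :: "complex ^ 'n ^ 'n \<Rightarrow> complex"
  assumes "entry_polynomial p"
  shows "\<exists>D. (\<forall>i j. entry_polynomial (D i j)) \<and>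
    (\<forall>x. (p has_derivative (\<lambda>h. \<Sum>i\<in>UNIV. \<Sum>j\<in>UNIV. D i j x * h $ i $ j)) (at x))"
  using assms
proof induction
  case (const c)
  show ?case by (intro exI[of _ "\<lambda>i j x. 0"]) (auto intro: entry_polynomial.intros)
next
  case (entry k l)
  have "(\<Sum>j\<in>UNIV. (if i = k \<and> j = l then 1 else 0) * h $ i $ j) =
      (if i = k then h $ k $ l else 0)" for h :: "complex ^ 'n ^ 'n" and i
  proof -
    have "(\<Sum>j\<in>UNIV. (if i = k \<and> j = l then 1 else 0) * h $ i $ j) =
        (\<Sum>j\<in>UNIV. if j = l then (if i = k then h $ k $ l else 0) else 0)"
      by (intro sum.cong) auto
    then show ?thesis by simp
  qed
  then show ?case
    by (intro exI[of _ "\<lambda>i j x. if i = k \<and> j = l then 1 else 0"])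
      (auto intro!: entry_polynomial_if entry_polynomial.intros has_derivative_entry)
next
  case (add p q)
  then obtain D1 D2 where "\<forall>i j. entry_polynomial (D1 i j)" "\<forall>i j. entry_polynomial (D2 i j)"
    and d: "\<And>x. (p has_derivative (\<lambda>h. \<Sum>i\<in>UNIV. \<Sum>j\<in>UNIV. D1 i j x * h $ i $ j)) (at x)"
    "\<And>x. (q has_derivative (\<lambda>h. \<Sum>i\<in>UNIV. \<Sum>j\<in>UNIV. D2 i j x * h $ i $ j)) (at x)"
    by auto
  then show ?case
    by (intro exI[of _ "\<lambda>i j x. D1 i j x + D2 i j x"])
      (auto intro!: entry_polynomial.intros derivative_eq_intros ext
        simp: algebra_simps sum.distrib)
next
  case (mult p q)
  then obtain D1 D2 where "\<forall>i j. entry_polynomial (D1 i j)" "\<forall>i j. entry_polynomial (D2 i j)"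
    and d: "\<And>x. (p has_derivative (\<lambda>h. \<Sum>i\<in>UNIV. \<Sum>j\<in>UNIV. D1 i j x * h $ i $ j)) (at x)"
    "\<And>x. (q has_derivative (\<lambda>h. \<Sum>i\<in>UNIV. \<Sum>j\<in>UNIV. D2 i j x * h $ i $ j)) (at x)"
    by auto
  have "p x * (\<Sum>i\<in>UNIV. \<Sum>j\<in>UNIV. D2 i j x * h $ i $ j) +
      (\<Sum>i\<in>UNIV. \<Sum>j\<in>UNIV. D1 i j x * h $ i $ j) * q x =
      (\<Sum>i\<in>UNIV. \<Sum>j\<in>UNIV. (p x * D2 i j x + D1 i j x * q x) * h $ i $ j)" for x h
    unfolding distrib_right sum.distrib sum_distrib_left sum_distrib_right
    by (simp add: ac_simps)
  then have "((\<lambda>x. p x * q x) has_derivative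
      (\<lambda>h. \<Sum>i\<in>UNIV. \<Sum>j\<in>UNIV. (p x * D2 i j x + D1 i j x * q x) * h $ i $ j)) (at x)" for x
    using has_derivative_mult[OF d] by simp
  with mult.hyps \<open>\<forall>i j. entry_polynomial (D1 i j)\<close> \<open>\<forall>i j. entry_polynomial (D2 i j)\<close>
  show ?case
    by (intro exI[of _ "\<lambda>i j x. p x * D2 i j x + D1 i j x * q x"])
      (auto intro!: entry_polynomial.intros)
qed

lemma entry_polynomial_isCont: "entry_polynomial p \<Longrightarrow> isCont p x"
  using entry_polynomial_has_derivative has_derivative_continuous by blast

lemma entry_polynomial_continuous_on: "entry_polynomial p \<Longrightarrow> continuous_on S p"
  by (simp add: continuous_at_imp_continuous_on entry_polynomial_isCont)

lemma open_entry_polynomial_nonzero: "entry_polynomial p \<Longrightarrow> open {x. p x \<noteq> 0}"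
  by (intro open_Collect_neq entry_polynomial_continuous_on continuous_on_const)

section \<open>Zeros of polynomials on complex lines\<close>

text \<open>The parameter is complex rather than real: the zeros of a polynomial are then finitely
  many points of a plane, whose removal leaves a connected set.\<close>

definition mat_line :: "complex ^ 'n ^ 'n \<Rightarrow> complex ^ 'n ^ 'n \<Rightarrow> complex \<Rightarrow> complex ^ 'n ^ 'n" where
  "mat_line a b s = (\<chi> i j. a $ i $ j + s * (b $ i $ j - a $ i $ j))"

lemma mat_line_ends [simp]: "mat_line a b 0 = a" "mat_line a b 1 = b"
  by (auto simp: mat_line_def vec_eq_iff)

lemma continuous_on_mat_line: "continuous_on S (mat_line a b)"
  unfolding mat_line_def by (intro continuous_on_vec_lambda continuous_intros)

lemma entry_polynomial_mat_line:
  assumes "entry_polynomial p"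
  shows "\<exists>P. \<forall>s. p (mat_line a b s) = poly P s"
  using assms
proof induction
  case (const c)
  show ?case by (intro exI[of _ "[:c:]"]) simp
next
  case (entry i j)
  show ?case by (intro exI[of _ "[:a $ i $ j, b $ i $ j - a $ i $ j:]"]) (simp add: mat_line_def)
next
  case (add p q)
  then show ?case by (metis poly_add)
next
  case (mult p q)
  then show ?case by (metis poly_mult)
qed

lemma finite_zeros_mat_line:
  assumes "entry_polynomial p" "p a \<noteq> 0 \<or> p b \<noteq> 0"
  shows "finite {s. p (mat_line a b s) = 0}"
proof -
  obtain P where P: "\<forall>s. p (mat_line a b s) = poly P s"
    using entry_polynomial_mat_line[OF assms(1)] by blast
  have "P \<noteq> 0" using P[rule_format, of 0] P[rule_format, of 1] assms(2) by auto
  then show ?thesis using P poly_roots_finite by simp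
qed

text \<open>The line from \<open>a\<close> to \<open>b\<close> stays in U for a nonempty open, hence
  infinite, set of parameters, and p vanishes on it for finitely many parameters only.\<close>

lemma entry_polynomial_nonzero_on_open:
  assumes p: "entry_polynomial p" "p b \<noteq> 0" and U: "open U" "a \<in> U"
  shows "\<exists>x\<in>U. p x \<noteq> 0"
proof -
  have "open (mat_line a b -` U)"
    using continuous_on_mat_line U(1) by (blast intro: open_vimage)
  moreover have "0 \<in> mat_line a b -` U" using U(2) by simp
  ultimately have "infinite (mat_line a b -` U)"
    using finite_imp_not_open by blast
  moreover have "finite {s. p (mat_line a b s) = 0}"
    by (rule finite_zeros_mat_line) (use p in auto)
  ultimately have "\<exists>s. s \<in> mat_line a b -` U - {s. p (mat_line a b s) = 0}"
    by (metis Diff_infinite_finite ex_in_conv infinite_imp_nonempty)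
  then show ?thesis by auto
qed

text \<open>The open set where p does not vanish is nonempty, so it contains a point where q does
  not vanish. In this way finitely many generic conditions are combined into one polynomial.\<close>

lemma entry_polynomial_mult_nonzero:
  assumes "entry_polynomial p" "entry_polynomial q" "p a \<noteq> 0" "q b \<noteq> 0"
  shows "\<exists>x. p x * q x \<noteq> 0"
  using entry_polynomial_nonzero_on_open[OF assms(2,4) open_entry_polynomial_nonzero[OF assms(1)]]
    assms(3) by auto

lemma entry_polynomial_prod_nonzero:
  assumes "finite I" "\<And>i. i \<in> I \<Longrightarrow> entry_polynomial (p i)" "\<And>i. i \<in> I \<Longrightarrow> \<exists>x. p i x \<noteq> 0"
  shows "\<exists>x. (\<Prod>i\<in>I. p i x) \<noteq> 0"
  using assms
proof (induction I)
  case (insert i I)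
  obtain a where a: "p i a \<noteq> 0" using insert.prems(2)[of i] by blast
  obtain b where b: "(\<Prod>i\<in>I. p i b) \<noteq> 0" using insert by blast
  show ?case
    unfolding prod.insert[OF insert.hyps]
    by (rule entry_polynomial_mult_nonzero[where p = "p i" and a = a and b = b])
      (use insert.prems a b in \<open>auto intro: entry_polynomial_prod\<close>)
qed simp

section \<open>Algebraic dependence\<close>

text \<open>Gaussian elimination: equation \<open>b\<close> is solved for an unknown
  \<open>a0\<close> with nonzero coefficient and substituted into the others, which leaves one
  equation and one unknown fewer.\<close>

lemma underdetermined_system:
  fixes c :: "'a \<Rightarrow> 'b \<Rightarrow> 'c::field"
  assumes "finite B" "finite A" "card B < card A"
  shows "\<exists>u. (\<exists>a\<in>A. u a \<noteq> 0) \<and> (\<forall>b\<in>B. (\<Sum>a\<in>A. u a * c a b) = 0)"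
  using assms
proof (induction B arbitrary: A c rule: finite_induct)
  case empty
  then have "A \<noteq> {}" by auto
  then show ?case by (intro exI[of _ "\<lambda>_. 1"]) auto
next
  case (insert b B)
  show ?case
  proof (cases "\<forall>a\<in>A. c a b = 0")
    case True
    have "card B < card A" using insert by simp
    from insert.IH[OF insert.prems(1) this, of c] True show ?thesis by force
  next
    case False
    then obtain a0 where a0: "a0 \<in> A" "c a0 b \<noteq> 0" by auto
    define A' where "A' = A - {a0}"
    have A': "finite A'" "card B < card A'" "a0 \<notin> A'" "A = insert a0 A'"
      using insert a0 by (auto simp: A'_def)
    obtain u where u: "\<exists>a\<in>A'. u a \<noteq> 0"
      "\<forall>b'\<in>B. (\<Sum>a\<in>A'. u a * (c a b' - c a b / c a0 b * c a0 b')) = 0"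
      using insert.IH[OF A'(1,2), of "\<lambda>a b'. c a b' - c a b / c a0 b * c a0 b'"] by blast
    define s where "s = (\<Sum>a\<in>A'. u a * c a b)"
    define w where "w a = (if a = a0 then - s / c a0 b else u a)" for a
    have w: "(\<Sum>a\<in>A. w a * c a b') = - s / c a0 b * c a0 b' + (\<Sum>a\<in>A'. u a * c a b')" for b'
    proof -
      have "(\<Sum>a\<in>A'. w a * c a b') = (\<Sum>a\<in>A'. u a * c a b')"
        by (rule sum.cong) (use A'(3) in \<open>auto simp: w_def\<close>)
      then show ?thesis using A' by (simp add: w_def)
    qed
    have "(\<Sum>a\<in>A. w a * c a b') = 0" if "b' \<in> B" for b'
    proof -
      have "0 = (\<Sum>a\<in>A'. u a * c a b') - s / c a0 b * c a0 b'"
        using u(2) that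
        by (simp add: s_def algebra_simps sum_subtractf sum_distrib_left sum_distrib_right
            sum_divide_distrib)
      then show ?thesis by (simp add: w)
    qed
    moreover have "(\<Sum>a\<in>A. w a * c a b) = 0" using a0(2) by (simp add: w s_def)
    moreover have "\<exists>a\<in>A. w a \<noteq> 0" using u(1) A' by (auto simp: w_def)
    ultimately show ?thesis by (intro exI[of _ w]) auto
  qed
qed

text \<open>Singling out the variable i gives a polynomial in one variable \<open>z\<close> whose
  coefficients are sums over the other variables. It vanishes for all \<open>z\<close>, so these
  coefficients vanish, and the induction hypothesis applies to each of them.\<close>

lemma multivariate_coeffs_zero:
  fixes a :: "('i \<Rightarrow> nat) \<Rightarrow> complex"
  assumes "finite I" "\<And>y. (\<Sum>\<alpha>\<in>PiE I (\<lambda>_. {..N}). a \<alpha> * (\<Prod>i\<in>I. y i ^ \<alpha> i)) = 0"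
    and "\<alpha> \<in> PiE I (\<lambda>_. {..N})"
  shows "a \<alpha> = 0"
  using assms
proof (induction I arbitrary: a \<alpha> rule: finite_induct)
  case empty
  then show ?case by simp
next
  case (insert i I)
  let ?P = "PiE I (\<lambda>_. {..N})"
  have inj: "inj_on (\<lambda>(k, g). g(i := k)) ({..N} \<times> ?P)"
    using inj_combinator[OF insert.hyps(2), of "\<lambda>_. {..N}"] .
  have *: "(\<Sum>k\<le>N. (\<Sum>\<alpha>\<in>?P. a (\<alpha>(i := k)) * (\<Prod>j\<in>I. y j ^ \<alpha> j)) * z ^ k) = 0" for y z
  proof -
    have "0 = (\<Sum>\<alpha>\<in>(\<lambda>(k, g). g(i := k)) ` ({..N} \<times> ?P).
        a \<alpha> * (\<Prod>j\<in>insert i I. (y(i := z)) j ^ \<alpha> j))"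
      using insert.prems(1)[of "y(i := z)"] by (simp add: PiE_insert_eq)
    also have "\<dots> = (\<Sum>(k, \<alpha>)\<in>{..N} \<times> ?P. a (\<alpha>(i := k)) *
        (\<Prod>j\<in>insert i I. (y(i := z)) j ^ (\<alpha>(i := k)) j))"
      by (subst sum.reindex[OF inj]) (simp add: case_prod_unfold)
    also have "\<dots> = (\<Sum>(k, \<alpha>)\<in>{..N} \<times> ?P. a (\<alpha>(i := k)) * (\<Prod>j\<in>I. y j ^ \<alpha> j) * z ^ k)"
    proof (intro sum.cong refl, clarify)
      fix k \<alpha>
      have "(\<Prod>j\<in>I. (y(i := z)) j ^ (\<alpha>(i := k)) j) = (\<Prod>j\<in>I. y j ^ \<alpha> j)"
        by (rule prod.cong) (use insert.hyps(2) in auto)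
      then show "a (\<alpha>(i := k)) * (\<Prod>j\<in>insert i I. (y(i := z)) j ^ (\<alpha>(i := k)) j) =
          a (\<alpha>(i := k)) * (\<Prod>j\<in>I. y j ^ \<alpha> j) * z ^ k"
        using insert.hyps by simp
    qed
    finally show ?thesis by (simp add: sum.cartesian_product sum_distrib_right)
  qed
  have "(\<Sum>\<alpha>\<in>?P. a (\<alpha>(i := k)) * (\<Prod>j\<in>I. y j ^ \<alpha> j)) = 0" if "k \<le> N" for k y
    using *[of y] that polyfun_eq_0[of "\<lambda>k. \<Sum>\<alpha>\<in>?P. a (\<alpha>(i := k)) * (\<Prod>j\<in>I. y j ^ \<alpha> j)" N] by blast
  from insert.IH[OF this] have "a (\<alpha>(i := k)) = 0" if "\<alpha> \<in> ?P" "k \<le> N" for k \<alpha>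
    using that by blast
  then show ?case
    using insert.prems(2) by (auto simp: PiE_insert_eq)
qed

section \<open>Monomials with bounded exponents\<close>

definition entry_monomial :: "('n \<times> 'n \<Rightarrow> nat) \<Rightarrow> complex ^ 'n ^ 'n \<Rightarrow> complex" where
  "entry_monomial \<alpha> x = (\<Prod>ij\<in>UNIV. (x $ fst ij $ snd ij) ^ \<alpha> ij)"

definition exponents :: "nat \<Rightarrow> ('n \<times> 'n \<Rightarrow> nat) set" where
  "exponents M = PiE UNIV (\<lambda>_. {..M})"

text \<open>The degree is bounded in each variable separately and not in total, so that the
  admissible exponents form a box and their number is a plain power.\<close>

definition box_poly :: "nat \<Rightarrow> (complex ^ 'n ^ 'n \<Rightarrow> complex) \<Rightarrow> bool" where
  "box_poly M p \<longleftrightarrow> (\<exists>c. \<forall>x. p x = (\<Sum>\<alpha>\<in>exponents M. c \<alpha> * entry_monomial \<alpha> x))"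

lemma finite_exponents [simp]: "finite (exponents M :: ('n::finite \<times> 'n \<Rightarrow> nat) set)"
  by (simp add: exponents_def finite_PiE)

lemma card_exponents: "card (exponents M :: ('n::finite \<times> 'n \<Rightarrow> nat) set) = (M + 1) ^ CARD('n \<times> 'n)"
  by (simp add: exponents_def card_PiE)

lemma mem_exponents: "\<alpha> \<in> exponents M \<longleftrightarrow> (\<forall>ij. \<alpha> ij \<le> M)"
  by (auto simp: exponents_def PiE_def)

lemma box_poly_monomial:
  assumes "\<And>ij. \<alpha> ij \<le> M"
  shows "box_poly M (\<lambda>x. c * entry_monomial \<alpha> x)"
  unfolding box_poly_def
proof (intro exI allI)
  show "c * entry_monomial \<alpha> x =
      (\<Sum>\<beta>\<in>exponents M. (if \<beta> = \<alpha> then c else 0) * entry_monomial \<beta> x)" for x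
    using assms by (simp add: if_distrib[of "\<lambda>u. u * _"] mem_exponents cong: if_cong)
qed

lemma box_poly_sum:
  assumes "\<And>i. i \<in> I \<Longrightarrow> box_poly M (p i)"
  shows "box_poly M (\<lambda>x. \<Sum>i\<in>I. p i x)"
proof -
  obtain c where "\<forall>i\<in>I. \<forall>x. p i x = (\<Sum>\<alpha>\<in>exponents M. c i \<alpha> * entry_monomial \<alpha> x)"
    using assms unfolding box_poly_def by metis
  then have "(\<Sum>i\<in>I. p i x) = (\<Sum>\<alpha>\<in>exponents M. (\<Sum>i\<in>I. c i \<alpha>) * entry_monomial \<alpha> x)" for x
    by (simp add: sum_distrib_right sum.swap[of _ I])
  then show ?thesis unfolding box_poly_def by (intro exI[of _ "\<lambda>\<alpha>. \<Sum>i\<in>I. c i \<alpha>"] allI)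
qed

lemma box_poly_mult:
  assumes "box_poly M p" "box_poly M' q"
  shows "box_poly (M + M') (\<lambda>x. p x * q x)"
proof -
  obtain c d where c: "\<And>x. p x = (\<Sum>\<alpha>\<in>exponents M. c \<alpha> * entry_monomial \<alpha> x)"
    and d: "\<And>x. q x = (\<Sum>\<alpha>\<in>exponents M'. d \<alpha> * entry_monomial \<alpha> x)"
    using assms unfolding box_poly_def by blast
  have "(\<lambda>x. p x * q x) = (\<lambda>x. \<Sum>\<alpha>\<in>exponents M. \<Sum>\<beta>\<in>exponents M'.
      (c \<alpha> * d \<beta>) * entry_monomial (\<lambda>ij. \<alpha> ij + \<beta> ij) x)"
    by (simp add: c d sum_product entry_monomial_def power_add prod.distrib ac_simps)
  moreover have "box_poly (M + M') \<dots>"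
    by (intro box_poly_sum box_poly_monomial) (auto simp: mem_exponents intro: add_mono)
  ultimately show ?thesis by simp
qed

lemma box_poly_const: "box_poly M (\<lambda>x. c)"
  using box_poly_monomial[of "\<lambda>_. 0" M c] by (simp add: entry_monomial_def)

lemma box_poly_mono:
  assumes "box_poly M p" "M \<le> M'"
  shows "box_poly M' p"
  using box_poly_mult[OF assms(1) box_poly_const[of "M' - M" 1]] assms(2) by simp

lemma box_poly_entry: "box_poly (Suc 0) (\<lambda>x. x $ i $ j)"
proof -
  have "(\<lambda>x. 1 * entry_monomial (\<lambda>ij. if ij = (i, j) then 1 else 0) x) = (\<lambda>x. x $ i $ j)"
    by (simp add: entry_monomial_def if_distrib[of "\<lambda>k. _ ^ k"] cong: if_cong)
  with box_poly_monomial[of "\<lambda>ij. if ij = (i, j) then 1 else 0" "Suc 0" 1] show ?thesis by simp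
qed

lemma box_poly_power: "box_poly M p \<Longrightarrow> box_poly (k * M) (\<lambda>x. p x ^ k)"
  by (induction k) (auto intro: box_poly_const box_poly_mult)

lemma box_poly_prod:
  assumes "\<And>i. i \<in> I \<Longrightarrow> box_poly (M i) (p i)"
  shows "box_poly (\<Sum>i\<in>I. M i) (\<lambda>x. \<Prod>i\<in>I. p i x)"
  using assms by (induction I rule: infinite_finite_induct) (auto intro: box_poly_const box_poly_mult)

lemma box_poly_add:
  assumes "box_poly M p" "box_poly M q"
  shows "box_poly M (\<lambda>x. p x + q x)"
  using box_poly_sum[of UNIV M "\<lambda>b. if b then p else q"] assms by (simp add: UNIV_bool add.commute)

lemma entry_polynomial_box_poly: "entry_polynomial p \<Longrightarrow> \<exists>M. box_poly M p"
proof (induction rule: entry_polynomial.induct)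
  case (add p q)
  then obtain M M' where "box_poly M p" "box_poly M' q" by auto
  then have "box_poly (M + M') (\<lambda>x. p x + q x)"
    by (intro box_poly_add) (auto elim: box_poly_mono)
  then show ?case by blast
qed (blast intro: box_poly_const box_poly_entry box_poly_mult)+

lemma entry_polynomial_monomial: "entry_polynomial (entry_monomial \<alpha>)"
  unfolding entry_monomial_def
  by (intro entry_polynomial_prod entry_polynomial_power entry_polynomial.entry)

text \<open>
  Counting monomials: the products of powers of more functions than there are variables
  outnumber the monomials of the corresponding degree.
\<close>

lemma algebraic_relation:
  fixes G :: "complex ^ 'n ^ 'n \<Rightarrow> complex ^ 'n ^ 'n"
  assumes G: "\<And>i j. entry_polynomial (\<lambda>x. G x $ i $ j)"
    and q: "entry_polynomial q" and H: "entry_polynomial H"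
  shows "\<exists>N A. (\<forall>k. entry_polynomial (A k)) \<and> (\<exists>k\<le>N. \<exists>y. A k y \<noteq> 0) \<and>
    (\<forall>x. q x \<noteq> 0 \<longrightarrow> (\<Sum>k\<le>N. A k (\<chi> i j. G x $ i $ j / q x) * (H x / q x) ^ k) = 0)"
proof -
  let ?m = "CARD('n \<times> 'n)"
  obtain eG where eG: "\<And>i j. box_poly (eG i j) (\<lambda>x. G x $ i $ j)"
    using entry_polynomial_box_poly[OF G] by metis
  obtain eq where eq: "box_poly eq q" using entry_polynomial_box_poly[OF q] by metis
  obtain eH where eH: "box_poly eH H" using entry_polynomial_box_poly[OF H] by metis
  define e where "e = (\<Sum>i\<in>UNIV. \<Sum>j\<in>UNIV. eG i j) + eq + eH"
  have "eG i j \<le> (\<Sum>i\<in>UNIV. \<Sum>j\<in>UNIV. eG i j)" for i j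
    using member_le_sum[of j UNIV "eG i"] member_le_sum[of i UNIV "\<lambda>i. \<Sum>j\<in>UNIV. eG i j"] by force
  then have "eG i j \<le> e" for i j by (simp add: e_def trans_le_add1)
  then have bG: "box_poly e (\<lambda>x. G x $ i $ j)" for i j by (rule box_poly_mono[OF eG])
  have bq: "box_poly e q" by (rule box_poly_mono[OF eq]) (simp add: e_def)
  have bH: "box_poly e H" by (rule box_poly_mono[OF eH]) (simp add: e_def)
  \<comment> \<open>With m the number of entries there are (N + 1) ^ (m + 1) products, of degree at
    most L, and (e * L + 1) ^ m monomials. Since e * L + 1 \<le> C * (N + 1), taking N = C ^ m
    bounds the latter number by N * (N + 1) ^ m, which is smaller.\<close>
  define C where "C = e * (?m + 1) + 1"
  define N where "N = C ^ ?m"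
  define L where "L = N * (?m + 1)"
  define deg where "deg \<alpha> = (\<Sum>ij\<in>UNIV. \<alpha> ij)" for \<alpha> :: "'n \<times> 'n \<Rightarrow> nat"
  let ?X = "exponents N :: ('n \<times> 'n \<Rightarrow> nat) set"
  let ?A = "?X \<times> {..N}"
  let ?B = "exponents (e * L) :: ('n \<times> 'n \<Rightarrow> nat) set"
  have deg_le: "deg \<alpha> + k \<le> L" if "(\<alpha>, k) \<in> ?A" for \<alpha> k
  proof -
    have "deg \<alpha> \<le> (\<Sum>ij\<in>(UNIV :: ('n \<times> 'n) set). N)"
      unfolding deg_def using that by (intro sum_mono) (auto simp: mem_exponents)
    then have "deg \<alpha> \<le> N * ?m" by (simp add: mult.commute)
    moreover have "L = N * ?m + N" "k \<le> N" using that by (simp_all add: L_def)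
    ultimately show ?thesis by linarith
  qed
  \<comment> \<open>A product of powers of the entries of G / q and of H / q, multiplied by q ^ L to
    clear all denominators.\<close>
  define \<phi> where "\<phi> a x = entry_monomial (fst a) (G x) * H x ^ snd a * q x ^ (L - deg (fst a) - snd a)"
    for a x
  have "box_poly (e * L) (\<phi> a)" if "a \<in> ?A" for a
  proof -
    obtain \<alpha> k where a: "a = (\<alpha>, k)" by (cases a)
    have "box_poly (\<Sum>ij\<in>UNIV. \<alpha> ij * e) (\<lambda>x. entry_monomial \<alpha> (G x))"
      unfolding entry_monomial_def by (intro box_poly_prod box_poly_power bG)
    then have "box_poly ((\<Sum>ij\<in>UNIV. \<alpha> ij * e) + k * e + (L - deg \<alpha> - k) * e) (\<phi> a)"
      unfolding \<phi>_def a fst_conv snd_conv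
      by (intro box_poly_mult box_poly_power bH bq)
    moreover have "(\<Sum>ij\<in>UNIV. \<alpha> ij * e) + k * e + (L - deg \<alpha> - k) * e = e * L"
      using deg_le[of \<alpha> k] that a
      by (simp flip: sum_distrib_right deg_def add_mult_distrib)
    ultimately show ?thesis by simp
  qed
  then have "\<forall>a\<in>?A. \<exists>c. \<forall>x. \<phi> a x = (\<Sum>\<beta>\<in>?B. c \<beta> * entry_monomial \<beta> x)"
    unfolding box_poly_def by blast
  then obtain c where c: "\<And>a x. a \<in> ?A \<Longrightarrow> \<phi> a x = (\<Sum>\<beta>\<in>?B. c a \<beta> * entry_monomial \<beta> x)"
    by metis
  have "card ?B < card ?A"
  proof -
    have "e * L + 1 \<le> C * (N + 1)" by (simp add: C_def L_def algebra_simps)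
    then have "card ?B \<le> (C * (N + 1)) ^ ?m" unfolding card_exponents by (rule power_mono) simp
    also have "\<dots> = N * (N + 1) ^ ?m" by (simp only: power_mult_distrib N_def)
    also have "\<dots> < (N + 1) * (N + 1) ^ ?m" by simp
    also have "\<dots> = card ?A" by (simp only: card_cartesian_product card_exponents) simp
    finally show ?thesis .
  qed
  then obtain u where u: "\<exists>a\<in>?A. u a \<noteq> 0" "\<And>\<beta>. \<beta> \<in> ?B \<Longrightarrow> (\<Sum>a\<in>?A. u a * c a \<beta>) = 0"
    using underdetermined_system[of ?B ?A c] by force
  define A where "A k y = (\<Sum>\<alpha>\<in>?X. u (\<alpha>, k) * entry_monomial \<alpha> y)" for k y
  have "entry_polynomial (A k)" for k
    unfolding A_def by (intro entry_polynomial_intros entry_polynomial_monomial)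
  moreover have "\<exists>k\<le>N. \<exists>y. A k y \<noteq> 0"
  \<comment> \<open>Otherwise all the \<open>A k\<close> with k \<le> N vanish identically, and
    independence of the monomials makes the whole solution \<open>u\<close> zero.\<close>
  proof (rule ccontr)
    assume "\<not> ?thesis"
    then have z: "A k y = 0" if "k \<le> N" for k y using that by blast
    have "u (\<alpha>, k) = 0" if "\<alpha> \<in> ?X" "k \<le> N" for \<alpha> k
    proof (rule multivariate_coeffs_zero[where I = UNIV and N = N and a = "\<lambda>\<alpha>. u (\<alpha>, k)"])
      fix y :: "'n \<times> 'n \<Rightarrow> complex"
      show "(\<Sum>\<alpha>\<in>PiE UNIV (\<lambda>_. {..N}). u (\<alpha>, k) * (\<Prod>i\<in>UNIV. y i ^ \<alpha> i)) = 0"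
        using z[OF that(2), of "\<chi> i j. y (i, j)"]
        by (simp add: A_def exponents_def entry_monomial_def)
    qed (use that in \<open>auto simp: exponents_def\<close>)
    with u(1) show False by auto
  qed
  moreover have "(\<Sum>k\<le>N. A k (\<chi> i j. G x $ i $ j / q x) * (H x / q x) ^ k) = 0"
    if "q x \<noteq> 0" for x
  proof -
    have "(\<Sum>a\<in>?A. u a * \<phi> a x) = (\<Sum>a\<in>?A. \<Sum>\<beta>\<in>?B. u a * c a \<beta> * entry_monomial \<beta> x)"
      by (intro sum.cong refl) (simp add: c sum_distrib_left mult.assoc)
    also have "\<dots> = (\<Sum>\<beta>\<in>?B. (\<Sum>a\<in>?A. u a * c a \<beta>) * entry_monomial \<beta> x)"
      by (subst sum.swap) (simp add: sum_distrib_right)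
    also have "\<dots> = 0" by (simp add: u(2))
    finally have 0: "(\<Sum>a\<in>?A. u a * \<phi> a x) = 0" .
    have "\<phi> (\<alpha>, k) x = q x ^ L * (entry_monomial \<alpha> (\<chi> i j. G x $ i $ j / q x) * (H x / q x) ^ k)"
      if "(\<alpha>, k) \<in> ?A" for \<alpha> k
    proof -
      have "entry_monomial \<alpha> (\<chi> i j. G x $ i $ j / q x) = entry_monomial \<alpha> (G x) / q x ^ deg \<alpha>"
        by (simp add: entry_monomial_def deg_def power_divide prod_dividef power_sum)
      moreover have "q x ^ L = q x ^ deg \<alpha> * q x ^ k * q x ^ (L - deg \<alpha> - k)"
        using deg_le[OF that] by (simp flip: power_add)
      ultimately show ?thesis using \<open>q x \<noteq> 0\<close> by (simp add: \<phi>_def power_divide field_simps)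
    qed
    then have "(\<Sum>a\<in>?A. u a * \<phi> a x) = (\<Sum>(\<alpha>, k)\<in>?A.
        q x ^ L * (u (\<alpha>, k) * entry_monomial \<alpha> (\<chi> i j. G x $ i $ j / q x) * (H x / q x) ^ k))"
      by (intro sum.cong refl) (auto simp: ac_simps)
    also have "\<dots> = q x ^ L * (\<Sum>\<alpha>\<in>?X. \<Sum>k\<le>N.
        u (\<alpha>, k) * entry_monomial \<alpha> (\<chi> i j. G x $ i $ j / q x) * (H x / q x) ^ k)"
      by (simp only: sum_distrib_left sum.cartesian_product) (simp add: case_prod_unfold)
    also have "\<dots> = q x ^ L * (\<Sum>k\<le>N. A k (\<chi> i j. G x $ i $ j / q x) * (H x / q x) ^ k)"
      by (subst sum.swap) (simp add: A_def sum_distrib_right)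
    finally show ?thesis using 0 that by simp
  qed
  ultimately show ?thesis by blast
qed

section \<open>Fibres of rational maps\<close>

lemma has_derivative_vecI:
  fixes f :: "'a::euclidean_space \<Rightarrow> 'b::real_normed_vector ^ 'n"
  assumes "\<And>i. ((\<lambda>x. f x $ i) has_derivative (\<lambda>h. f' h $ i)) (at x)"
  shows "(f has_derivative f') (at x)"
proof -
  have "linear f'"
  proof (rule linearI)
    have l: "linear (\<lambda>h. f' h $ i)" for i
      using assms has_derivative_linear by blast
    show "f' (u + v) = f' u + f' v" for u v
      using linear_add[OF l] by (simp add: vec_eq_iff)
    show "f' (r *\<^sub>R u) = r *\<^sub>R f' u" for r u
      using linear_scale[OF l] by (simp add: vec_eq_iff)
  qed
  then have "bounded_linear f'" by (simp add: linear_conv_bounded_linear)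
  then show ?thesis
    using assms by (auto simp: has_derivative_at_within intro!: vec_tendstoI)
qed

lemma norm_le_sum_entries:
  fixes M :: "'a::real_normed_vector ^ 'n ^ 'm"
  shows "norm M \<le> (\<Sum>i\<in>UNIV. \<Sum>j\<in>UNIV. norm (M $ i $ j))"
proof -
  have "norm M \<le> (\<Sum>i\<in>UNIV. norm (M $ i))"
    unfolding norm_vec_def by (rule L2_set_le_sum) simp
  also have "\<dots> \<le> (\<Sum>i\<in>UNIV. \<Sum>j\<in>UNIV. norm (M $ i $ j))"
    by (intro sum_mono) (auto simp: norm_vec_def intro: L2_set_le_sum)
  finally show ?thesis .
qed

lemma norm_entry_le: "norm (M $ i $ j) \<le> norm (M :: 'a::real_normed_vector ^ 'n ^ 'm)"
  using Finite_Cartesian_Product.norm_nth_le[of "M $ i" j] Finite_Cartesian_Product.norm_nth_le[of M i] by linarith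

text \<open>An injective linear self-map in finite dimension has an inverse, as Sussmann's open
  mapping theorem demands. The derivative enters at the single point x, so later derivatives are
  computed at the exhibited solutions only.\<close>

lemma open_at_injective_derivative:
  fixes f :: "'a::euclidean_space \<Rightarrow> 'a"
  assumes "open S" "continuous_on S f" "x \<in> S" "(f has_derivative f') (at x)" "inj f'"
    and "T \<subseteq> S" "x \<in> interior T"
  shows "f x \<in> interior (f ` T)"
proof -
  have "linear f'" using assms(4) has_derivative_linear by blast
  then obtain g where "linear g" "f' \<circ> g = id"
    using eucl.linear_injective_isomorphism[of f'] assms(5) by (auto simp: fun_eq_iff)
  then show ?thesis
    using sussmann_open_mapping[OF assms(1-4) _ _ assms(6,7), of g]
    by (auto simp: linear_conv_bounded_linear)
qed

section \<open>Fibre cardinality of proper local homeomorphisms\<close>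

text \<open>The compact set K expresses properness near y. The fibre over y is compact, and local
  injectivity isolates its points, so it is finite. Small disjoint balls around them then match the
  preimages of a nearby point with those of y.\<close>

lemma fibre_card_locally_constant:
  fixes F :: "'a::heine_borel \<Rightarrow> 'b::metric_space"
  assumes U: "open U" "continuous_on U F"
    and inj: "\<And>x. x \<in> U \<Longrightarrow> F x = y \<Longrightarrow> \<exists>r>0. inj_on F (ball x r)"
    and op: "\<And>x r. x \<in> U \<Longrightarrow> F x = y \<Longrightarrow> r > 0 \<Longrightarrow> ball x r \<subseteq> U \<Longrightarrow> y \<in> interior (F ` ball x r)"
    and K: "compact K" "K \<subseteq> U"
    and proper: "\<forall>\<^sub>F y' in nhds y. \<forall>x\<in>U. F x = y' \<longrightarrow> x \<in> K"
  shows "finite {x \<in> U. F x = y}"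
    and "\<forall>\<^sub>F y' in nhds y. finite {x \<in> U. F x = y'} \<and> card {x \<in> U. F x = y'} = card {x \<in> U. F x = y}"
proof -
  let ?Y = "{x \<in> U. F x = y}"
  have YK: "?Y = K \<inter> F -` {y}"
    using K eventually_nhds_x_imp_x[OF proper] by auto
  have contK: "continuous_on K F" using U K continuous_on_subset by blast
  have cY: "compact ?Y"
    unfolding YK
    using compact_Int_closed[OF K(1) continuous_closed_preimage[OF contK compact_imp_closed[OF K(1)]],
        of "{y}"] by simp
  show fin: "finite ?Y"
  proof -
    obtain r where r: "\<And>x. x \<in> ?Y \<Longrightarrow> r x > 0 \<and> inj_on F (ball x (r x))"
      using inj bchoice[of ?Y "\<lambda>x r. r > 0 \<and> inj_on F (ball x r)"] by auto
    obtain Y' where Y': "Y' \<subseteq> ?Y" "finite Y'" "?Y \<subseteq> (\<Union>x\<in>Y'. ball x (r x))"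
      using compactE_image[OF cY, of ?Y "\<lambda>x. ball x (r x)"] r by force
    have "?Y \<subseteq> Y'"
    proof
      fix x assume x: "x \<in> ?Y"
      then obtain x' where x': "x' \<in> Y'" "x \<in> ball x' (r x')" using Y' by auto
      then have "x' \<in> ?Y" using Y' by auto
      with r[of x'] x x'(2) have "x = x'" by (auto dest: inj_onD)
      with x' show "x \<in> Y'" by simp
    qed
    then show ?thesis using Y'(2) finite_subset by blast
  qed
  have ev: "\<forall>\<^sub>F r in at_right 0. \<forall>x\<in>?Y. ball x r \<subseteq> U \<and> inj_on F (ball x r) \<and>
      (\<forall>x'\<in>?Y. x' \<noteq> x \<longrightarrow> ball x r \<inter> ball x' r = {})"
  proof (intro eventually_ball_finite[OF fin] ballI eventually_conj)
    fix x assume x: "x \<in> ?Y"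
    obtain s where "s > 0" "ball x s \<subseteq> U" using U(1) x open_contains_ball by blast
    then show "\<forall>\<^sub>F r in at_right 0. ball x r \<subseteq> U"
      by (intro eventually_at_rightI[of 0 s]) (auto simp: subset_iff)
    obtain s where "s > 0" "inj_on F (ball x s)" using inj x by blast
    then show "\<forall>\<^sub>F r in at_right 0. inj_on F (ball x r)"
      by (intro eventually_at_rightI[of 0 s]) (auto elim: inj_on_subset)
    fix x' assume x': "x' \<in> ?Y"
    show "\<forall>\<^sub>F r in at_right 0. x' \<noteq> x \<longrightarrow> ball x r \<inter> ball x' r = {}"
    proof (cases "x' = x")
      case False
      show ?thesis
      proof (rule eventually_at_rightI[of 0 "dist x x' / 2"])
        fix r assume "r \<in> {0<..<dist x x' / 2}"
        then show "x' \<noteq> x \<longrightarrow> ball x r \<inter> ball x' r = {}"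
          by (intro impI disjoint_ballI) auto
      qed (use False in auto)
    qed simp
  qed
  obtain r where r: "r > 0" "\<And>x. x \<in> ?Y \<Longrightarrow> ball x r \<subseteq> U" "\<And>x. x \<in> ?Y \<Longrightarrow> inj_on F (ball x r)"
    and disj: "\<And>x x'. x \<in> ?Y \<Longrightarrow> x' \<in> ?Y \<Longrightarrow> x \<noteq> x' \<Longrightarrow> ball x r \<inter> ball x' r = {}"
  proof -
    have "\<forall>\<^sub>F r in at_right 0. (r::real) > 0" by (simp add: eventually_at_right_less)
    from eventually_happens[OF eventually_conj[OF this ev]] that show ?thesis
      by (simp only: trivial_limit_at_right_real) blast
  qed
  \<comment> \<open>The first part of W gives a preimage in every ball, the second excludes
    preimages in K outside all the balls.\<close>
  define W where "W = (\<Inter>x\<in>?Y. interior (F ` ball x r)) \<inter> - F ` (K - (\<Union>x\<in>?Y. ball x r))"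
  have "compact (K - (\<Union>x\<in>?Y. ball x r))"
    by (intro compact_diff K open_UN ballI open_ball)
  then have "closed (F ` (K - (\<Union>x\<in>?Y. ball x r)))"
    by (intro compact_imp_closed compact_continuous_image)
      (auto intro: continuous_on_subset[OF contK])
  then have oW: "open W" unfolding W_def using fin by (intro open_Int open_INT) auto
  have yW: "y \<in> W"
    unfolding W_def
  proof (intro IntI INT_I ComplI)
    fix x assume "x \<in> ?Y"
    with r(1) r(2)[OF this] show "y \<in> interior (F ` ball x r)" by (intro op) simp_all
  next
    assume "y \<in> F ` (K - (\<Union>x\<in>?Y. ball x r))"
    then obtain x where x: "y = F x" "x \<in> K" "x \<notin> (\<Union>x\<in>?Y. ball x r)" by blast
    then have "x \<in> ?Y" using K(2) by blast
    with x(3) r(1) show False by auto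
  qed
  have "card {x \<in> U. F x = y'} = card ?Y \<and> finite {x \<in> U. F x = y'}"
    if y': "y' \<in> W" "\<forall>x\<in>U. F x = y' \<longrightarrow> x \<in> K" for y'
  proof -
    have "\<exists>x'\<in>ball x r. F x' = y'" if "x \<in> ?Y" for x
      using y'(1) that interior_subset unfolding W_def by fastforce
    then obtain g where g: "\<And>x. x \<in> ?Y \<Longrightarrow> g x \<in> ball x r \<and> F (g x) = y'"
      using bchoice[of ?Y "\<lambda>x x'. x' \<in> ball x r \<and> F x' = y'"] by blast
    have inj_g: "inj_on g ?Y"
    proof (rule inj_onI)
      fix a b assume "a \<in> ?Y" "b \<in> ?Y" "g a = g b"
      then have "g a \<in> ball a r \<inter> ball b r" using g by (metis IntI)
      with disj[OF \<open>a \<in> ?Y\<close> \<open>b \<in> ?Y\<close>] show "a = b" by blast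
    qed
    have im_g: "g ` ?Y = {x \<in> U. F x = y'}"
    proof (intro subset_antisym subsetI)
      fix x assume "x \<in> g ` ?Y"
      then show "x \<in> {x \<in> U. F x = y'}" using g r(2) by blast
    next
      fix x assume x: "x \<in> {x \<in> U. F x = y'}"
      then have "x \<in> K" using y'(2) by blast
      then obtain z where z: "z \<in> ?Y" "x \<in> ball z r" using x y'(1) unfolding W_def by blast
      then have "x = g z" using g[OF z(1)] r(3)[OF z(1)] x by (auto dest: inj_onD)
      then show "x \<in> g ` ?Y" using z(1) by blast
    qed
    show ?thesis using card_image[OF inj_g] finite_imageI[OF fin, of g] unfolding im_g by simp
  qed
  then have *: "finite {x \<in> U. F x = y'} \<and> card {x \<in> U. F x = y'} = card ?Y"
    if "y' \<in> W \<and> (\<forall>x\<in>U. F x = y' \<longrightarrow> x \<in> K)" for y'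
    using that by blast
  show "\<forall>\<^sub>F y' in nhds y. finite {x \<in> U. F x = y'} \<and> card {x \<in> U. F x = y'} = card ?Y"
    by (rule eventually_mono[OF eventually_conj[OF eventually_nhds_in_open[OF oW yW] proper] *])
qed

text \<open>Cauchy's bound for the roots of a monic polynomial: if z has norm above 1, all lower
  powers are dominated by the power m - 1, which is then cancelled.\<close>

lemma norm_root_le:
  fixes z :: complex
  assumes "z ^ m = - (\<Sum>k<m. c k * z ^ k)" and B: "(\<Sum>k<m. norm (c k)) \<le> B"
  shows "norm z \<le> max 1 B"
proof (cases "norm z \<le> 1")
  case False
  show ?thesis
  proof (cases m)
    case (Suc l)
    have "norm z * norm z ^ l = norm (\<Sum>k<m. c k * z ^ k)"
      by (metis Suc assms(1) norm_minus_cancel norm_power power_Suc)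
    also have "\<dots> \<le> (\<Sum>k<m. norm (c k) * norm z ^ k)"
      by (rule sum_norm_le) (simp add: norm_mult norm_power)
    also have "\<dots> \<le> (\<Sum>k<m. norm (c k) * norm z ^ l)"
      by (intro sum_mono mult_left_mono power_increasing) (use False Suc in auto)
    also have "\<dots> \<le> B * norm z ^ l"
      by (simp add: B mult_right_mono flip: sum_distrib_right)
    finally have "norm z * norm z ^ l \<le> B * norm z ^ l" .
    moreover have "0 < norm z ^ l" using False by (intro zero_less_power) linarith
    ultimately have "norm z \<le> B" by simp
    then show ?thesis by simp
  qed (use assms in simp)
qed simp

section \<open>Rational self-maps G / q of the matrix space\<close>

locale rational_matrix_map =
  fixes G :: "complex ^ 'n ^ 'n \<Rightarrow> complex ^ 'n ^ 'n" and q :: "complex ^ 'n ^ 'n \<Rightarrow> complex"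
  assumes G: "\<And>i j. entry_polynomial (\<lambda>x. G x $ i $ j)" and q: "entry_polynomial q"
begin

definition F :: "complex ^ 'n ^ 'n \<Rightarrow> complex ^ 'n ^ 'n" where
  "F x = (\<chi> i j. G x $ i $ j / q x)"

lemma open_domain: "open {x. q x \<noteq> 0}"
  using q by (rule open_entry_polynomial_nonzero)

lemma continuous_on_F: "continuous_on {x. q x \<noteq> 0} F"
  unfolding F_def
  by (intro continuous_on_vec_lambda continuous_on_divide entry_polynomial_continuous_on G q) auto

lemma isCont_F: "q x \<noteq> 0 \<Longrightarrow> isCont F x"
  using continuous_on_F open_domain by (simp add: continuous_on_eq_continuous_at)

text \<open>Where the leading coefficient of the algebraic relation does not vanish, the roots are bounded.\<close>

lemma bounded_on_fibres:
  assumes H: "entry_polynomial H"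
  shows "\<exists>p. entry_polynomial p \<and> (\<exists>y. p y \<noteq> 0) \<and>
    (\<forall>y. p y \<noteq> 0 \<longrightarrow> (\<exists>C. \<forall>\<^sub>F y' in nhds y. \<forall>x. q x \<noteq> 0 \<and> F x = y' \<longrightarrow> norm (H x / q x) \<le> C))"
proof -
  obtain N A where A: "\<And>k. entry_polynomial (A k)" and ex: "\<exists>k\<le>N. \<exists>y. A k y \<noteq> 0"
    and rel: "\<And>x. q x \<noteq> 0 \<Longrightarrow> (\<Sum>k\<le>N. A k (F x) * (H x / q x) ^ k) = 0"
    using algebraic_relation[OF G q H] unfolding F_def by blast
  define m where "m = (GREATEST k. k \<le> N \<and> (\<exists>y. A k y \<noteq> 0))"
  have m: "m \<le> N" "\<exists>y. A m y \<noteq> 0"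
    using GreatestI_ex_nat[of "\<lambda>k. k \<le> N \<and> (\<exists>y. A k y \<noteq> 0)" N] ex by (auto simp: m_def)
  have zero: "A k y = 0" if "k \<le> N" "m < k" for k y
    using Greatest_le_nat[of "\<lambda>k. k \<le> N \<and> (\<exists>y. A k y \<noteq> 0)" k N] that by (force simp: m_def)
  have "\<exists>C. \<forall>\<^sub>F y' in nhds y. \<forall>x. q x \<noteq> 0 \<and> F x = y' \<longrightarrow> norm (H x / q x) \<le> C"
    if y: "A m y \<noteq> 0" for y
  proof -
    define S where "S y' = (\<Sum>k<m. norm (A k y' / A m y'))" for y'
    have "isCont S y" unfolding S_def
      by (intro continuous_intros entry_polynomial_isCont A y)
    then have "\<forall>\<^sub>F y' in nhds y. S y' < S y + 1"
      by (intro order_tendstoD(2)[of S "S y"]) (auto simp: isCont_def tendsto_at_iff_tendsto_nhds)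
    moreover have "\<forall>\<^sub>F y' in nhds y. A m y' \<noteq> 0"
      using eventually_nhds_in_open[OF open_entry_polynomial_nonzero[OF A]] y by fastforce
    ultimately have "\<forall>\<^sub>F y' in nhds y. \<forall>x. q x \<noteq> 0 \<and> F x = y' \<longrightarrow> norm (H x / q x) \<le> max 1 (S y + 1)"
    proof eventually_elim
      case (elim y')
      show ?case
      proof clarify
        fix x assume x: "q x \<noteq> 0" "y' = F x"
        let ?z = "H x / q x"
        have "0 = (\<Sum>k\<le>m. A k (F x) * ?z ^ k)"
          unfolding rel[OF x(1), symmetric]
          by (rule sum.mono_neutral_right) (use m zero in auto)
        also have "\<dots> = A m (F x) * ?z ^ m + (\<Sum>k<m. A k (F x) * ?z ^ k)"
          by (simp add: lessThan_Suc_atMost[symmetric])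
        finally have "A m (F x) * ?z ^ m = - (\<Sum>k<m. A k (F x) * ?z ^ k)"
          by (simp add: eq_neg_iff_add_eq_0)
        then have "?z ^ m = - (\<Sum>k<m. A k (F x) * ?z ^ k) / A m (F x)"
          using elim(2) x(2) by (intro eq_divide_imp) (simp_all add: mult.commute[of _ "A m _"])
        also have "\<dots> = - (\<Sum>k<m. (A k (F x) / A m (F x)) * ?z ^ k)"
          by (simp add: sum_divide_distrib)
        finally show "norm ?z \<le> max 1 (S y + 1)"
          by (rule norm_root_le) (use elim(1) x(2) in \<open>auto simp: S_def\<close>)
      qed
    qed
    then show ?thesis by blast
  qed
  with A m(2) show ?thesis by blast
qed

text \<open>Where the lowest coefficient of the algebraic relation does not vanish, zero is not a root.\<close>

lemma nonvanishing_on_fibres: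
  assumes H: "entry_polynomial H" "H a \<noteq> 0"
  shows "\<exists>p. entry_polynomial p \<and> (\<exists>y. p y \<noteq> 0) \<and> (\<forall>x. q x \<noteq> 0 \<and> p (F x) \<noteq> 0 \<longrightarrow> H x \<noteq> 0)"
proof -
  obtain N A where A: "\<And>k. entry_polynomial (A k)" and ex: "\<exists>k\<le>N. \<exists>y. A k y \<noteq> 0"
    and rel: "\<And>x. q x \<noteq> 0 \<Longrightarrow> (\<Sum>k\<le>N. A k (F x) * (H x / q x) ^ k) = 0"
    using algebraic_relation[OF G q H(1)] unfolding F_def by blast
  define m where "m = (LEAST k. k \<le> N \<and> (\<exists>y. A k y \<noteq> 0))"
  have m: "m \<le> N" "\<exists>y. A m y \<noteq> 0"
    using LeastI_ex[of "\<lambda>k. k \<le> N \<and> (\<exists>y. A k y \<noteq> 0)"] ex by (auto simp: m_def)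
  have zero: "A k y = 0" if "k < m" for k y
    using not_less_Least[of k "\<lambda>k. k \<le> N \<and> (\<exists>y. A k y \<noteq> 0)"] that m(1) by (force simp: m_def)
  have "H x \<noteq> 0" if x: "q x \<noteq> 0" "A m (F x) \<noteq> 0" for x
  proof
    assume Hx: "H x = 0"
    \<comment> \<open>T is the relation divided by the power m of H / q. At x itself this division
      is impossible because H x = 0. At a nearby x' with H x' \<noteq> 0 it is possible and forces T
      x' = 0, whereas T x = A m (F x) is nonzero and T is continuous.\<close>
    define T where "T x = (\<Sum>k=m..N. A k (F x) * (H x / q x) ^ (k - m))" for x
    have contT: "isCont T x" unfolding T_def
      by (intro continuous_intros isCont_o2[OF isCont_F] entry_polynomial_isCont A H q x)
    have Tx: "T x \<noteq> 0"
    proof -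
      have "T x = (\<Sum>k=m..N. if k = m then A m (F x) else 0)"
        unfolding T_def by (rule sum.cong) (auto simp: Hx)
      then show ?thesis using m(1) x(2) by simp
    qed
    from contT have "(T \<longlongrightarrow> T x) (nhds x)"
      unfolding isCont_def tendsto_at_iff_tendsto_nhds .
    then have "\<forall>\<^sub>F x' in nhds x. T x' \<noteq> 0" using Tx by (rule tendsto_imp_eventually_ne)
    moreover have "\<forall>\<^sub>F x' in nhds x. q x' \<noteq> 0"
      using eventually_nhds_in_open[OF open_domain] x(1) by fastforce
    ultimately have "\<forall>\<^sub>F x' in nhds x. T x' \<noteq> 0 \<and> q x' \<noteq> 0" by (rule eventually_conj)
    then obtain V where V: "open V" "x \<in> V" "\<And>x'. x' \<in> V \<Longrightarrow> T x' \<noteq> 0 \<and> q x' \<noteq> 0"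
      unfolding eventually_nhds by blast
    obtain x' where x': "x' \<in> V" "H x' \<noteq> 0"
      using entry_polynomial_nonzero_on_open[OF H V(1,2)] by blast
    let ?z = "H x' / q x'"
    have "0 = (\<Sum>k=m..N. A k (F x') * ?z ^ k)"
      unfolding rel[OF conjunct2[OF V(3)[OF x'(1)]], symmetric]
      by (rule sum.mono_neutral_right) (use zero in auto)
    also have "\<dots> = ?z ^ m * T x'"
      unfolding T_def sum_distrib_left
      by (rule sum.cong) (auto simp: ac_simps simp flip: power_add)
    finally show False using V(3)[OF x'(1)] x'(2) by simp
  qed
  with A m(2) show ?thesis by blast
qed


lemma F_has_derivative:
  obtains J where "\<And>i j k l. entry_polynomial (J i j k l)"
    and "\<And>x. q x \<noteq> 0 \<Longrightarrow> (F has_derivative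
      (\<lambda>h. \<chi> i j. (\<Sum>k\<in>UNIV. \<Sum>l\<in>UNIV. J i j k l x * h $ k $ l) / (q x)\<^sup>2)) (at x)"
proof -
  let ?P = "\<lambda>p D. (\<forall>k l. entry_polynomial (D k l)) \<and>
    (\<forall>x. (p has_derivative (\<lambda>h. \<Sum>k\<in>UNIV. \<Sum>l\<in>UNIV. D k l x * h $ k $ l)) (at x))"
  define DG where "DG i j = (SOME D. ?P (\<lambda>x. G x $ i $ j) D)" for i j
  have DGP: "?P (\<lambda>x. G x $ i $ j) (DG i j)" for i j
    unfolding DG_def by (rule someI_ex[OF entry_polynomial_has_derivative[OF G]])
  then have DG: "entry_polynomial (DG i j k l)"
    and dG: "((\<lambda>x. G x $ i $ j) has_derivative
      (\<lambda>h. \<Sum>k\<in>UNIV. \<Sum>l\<in>UNIV. DG i j k l x * h $ k $ l)) (at x)" for i j k l x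
    by blast+
  obtain Dq where "?P q Dq" using entry_polynomial_has_derivative[OF q] by blast
  then have Dq: "entry_polynomial (Dq k l)"
    and dq: "(q has_derivative (\<lambda>h. \<Sum>k\<in>UNIV. \<Sum>l\<in>UNIV. Dq k l x * h $ k $ l)) (at x)" for k l x
    by blast+
  define J where "J i j k l x = DG i j k l x * q x - G x $ i $ j * Dq k l x" for i j k l x
  show thesis
  proof
    show "entry_polynomial (J i j k l)" for i j k l
      unfolding J_def by (intro entry_polynomial_intros DG Dq G q)
    fix x assume x: "q x \<noteq> 0"
    have "((\<lambda>x. G x $ i $ j / q x) has_derivative
        (\<lambda>h. (\<Sum>k\<in>UNIV. \<Sum>l\<in>UNIV. J i j k l x * h $ k $ l) / (q x)\<^sup>2)) (at x)" for i j
    proof -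
      have "((\<Sum>k\<in>UNIV. \<Sum>l\<in>UNIV. DG i j k l x * h $ k $ l) * q x -
          G x $ i $ j * (\<Sum>k\<in>UNIV. \<Sum>l\<in>UNIV. Dq k l x * h $ k $ l)) / (q x * q x) =
          (\<Sum>k\<in>UNIV. \<Sum>l\<in>UNIV. J i j k l x * h $ k $ l) / (q x)\<^sup>2" for h
        unfolding J_def left_diff_distrib sum_subtractf sum_distrib_left sum_distrib_right
          power2_eq_square by (simp add: ac_simps)
      with has_derivative_divide'[OF dG[of i j x] dq[of x] x] show ?thesis by simp
    qed
    then show "(F has_derivative
        (\<lambda>h. \<chi> i j. (\<Sum>k\<in>UNIV. \<Sum>l\<in>UNIV. J i j k l x * h $ k $ l) / (q x)\<^sup>2)) (at x)"
      unfolding F_def by (intro has_derivative_vecI) (simp add: has_derivative_vecI)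
  qed
qed

text \<open>Reading matrices as vectors indexed by pairs turns the derivative into a square complex
  matrix divided by q^2, and its determinant H detects injectivity. The last clause, continuity of
  the derivative in operator norm, is what local injectivity of F rests on.\<close>

lemma jacobian:
  obtains H DF where "entry_polynomial H"
    and "\<And>x. q x \<noteq> 0 \<Longrightarrow> (F has_derivative DF x) (at x)"
    and "\<And>x. q x \<noteq> 0 \<Longrightarrow> H x \<noteq> 0 \<longleftrightarrow> inj (DF x)"
    and "\<And>x e. q x \<noteq> 0 \<Longrightarrow> e > 0 \<Longrightarrow> \<forall>\<^sub>F x' in nhds x. onorm (\<lambda>v. DF x' v - DF x v) < e"
proof -
  obtain J where J: "\<And>i j k l. entry_polynomial (J i j k l)"
    and dF: "\<And>x. q x \<noteq> 0 \<Longrightarrow> (F has_derivative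
      (\<lambda>h. \<chi> i j. (\<Sum>k\<in>UNIV. \<Sum>l\<in>UNIV. J i j k l x * h $ k $ l) / (q x)\<^sup>2)) (at x)"
    using F_has_derivative by blast
  define DF where "DF x h = (\<chi> i j. (\<Sum>k\<in>UNIV. \<Sum>l\<in>UNIV. J i j k l x * h $ k $ l) / (q x)\<^sup>2)"
    for x and h :: "complex ^ 'n ^ 'n"
  define Jm where "Jm x = (\<chi> ij kl. J (fst ij) (snd ij) (fst kl) (snd kl) x)" for x
  define fl :: "complex ^ 'n ^ 'n \<Rightarrow> complex ^ ('n \<times> 'n)" where "fl h = (\<chi> ij. h $ fst ij $ snd ij)" for h
  have surj_fl: "\<exists>h. fl h = w" for w
    by (intro exI[of _ "\<chi> i j. w $ (i, j)"]) (simp add: fl_def vec_eq_iff)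
  have inj_fl: "fl h = fl h' \<longleftrightarrow> h = h'" for h h'
    by (auto simp: fl_def vec_eq_iff)
  have DF_Jm: "DF x h $ i $ j = (Jm x *v fl h) $ (i, j) / (q x)\<^sup>2" for x h i j
    by (simp add: DF_def matrix_vector_mult_def Jm_def fl_def sum.cartesian_product case_prod_unfold
        flip: UNIV_Times_UNIV)
  have inj_iff: "inj (DF x) \<longleftrightarrow> det (Jm x) \<noteq> 0" if "q x \<noteq> 0" for x
  proof -
    have *: "DF x h = DF x h' \<longleftrightarrow> Jm x *v fl h = Jm x *v fl h'" for h h'
      using that by (auto simp: vec_eq_iff DF_Jm)
    have "inj (DF x) \<longleftrightarrow> inj ((*v) (Jm x))"
      unfolding inj_def * by (metis inj_fl surj_fl)
    also have "\<dots> \<longleftrightarrow> det (Jm x) \<noteq> 0"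
      unfolding invertible_det_nz[symmetric] invertible_left_inverse matrix_left_invertible_injective ..
    finally show ?thesis .
  qed
  show thesis
  proof
    show "entry_polynomial (\<lambda>x. det (Jm x))"
      by (intro entry_polynomial_det) (simp add: Jm_def J)
    show "(F has_derivative DF x) (at x)" if "q x \<noteq> 0" for x
      using dF[OF that] unfolding DF_def .
    show "det (Jm x) \<noteq> 0 \<longleftrightarrow> inj (DF x)" if "q x \<noteq> 0" for x
      using inj_iff[OF that] ..
    fix x and e :: real assume x: "q x \<noteq> 0" and e: "e > 0"
    define B where "B x' = (\<Sum>i\<in>UNIV. \<Sum>j\<in>UNIV. \<Sum>k\<in>UNIV. \<Sum>l\<in>UNIV.
        norm (J i j k l x' / (q x')\<^sup>2 - J i j k l x / (q x)\<^sup>2))" for x'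
    have "isCont B x" unfolding B_def
      by (intro continuous_intros entry_polynomial_isCont J q) (use x in auto)
    then have "(B \<longlongrightarrow> B x) (nhds x)" unfolding isCont_def tendsto_at_iff_tendsto_nhds .
    moreover have "B x = 0" by (simp add: B_def)
    ultimately have "\<forall>\<^sub>F x' in nhds x. B x' < e" using e by (auto dest: order_tendstoD)
    moreover have "onorm (\<lambda>v. DF x' v - DF x v) \<le> B x'" for x'
    proof (rule onorm_le)
      fix v
      have "norm ((DF x' v - DF x v) $ i $ j) \<le>
          (\<Sum>k\<in>UNIV. \<Sum>l\<in>UNIV. norm (J i j k l x' / (q x')\<^sup>2 - J i j k l x / (q x)\<^sup>2) * norm v)" for i j
      proof -
        have "(DF x' v - DF x v) $ i $ j =
          (\<Sum>k\<in>UNIV. \<Sum>l\<in>UNIV. (J i j k l x' / (q x')\<^sup>2 - J i j k l x / (q x)\<^sup>2) * v $ k $ l)"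
          by (simp add: DF_def sum_divide_distrib left_diff_distrib sum_subtractf)
        also have "norm \<dots> \<le>
          (\<Sum>k\<in>UNIV. \<Sum>l\<in>UNIV. norm (J i j k l x' / (q x')\<^sup>2 - J i j k l x / (q x)\<^sup>2) * norm v)"
          by (intro sum_norm_le) (simp add: norm_mult mult_left_mono norm_entry_le)
        finally show ?thesis .
      qed
      then have "norm (DF x' v - DF x v) \<le> (\<Sum>i\<in>UNIV. \<Sum>j\<in>UNIV. \<Sum>k\<in>UNIV. \<Sum>l\<in>UNIV.
          norm (J i j k l x' / (q x')\<^sup>2 - J i j k l x / (q x)\<^sup>2) * norm v)"
        by (intro order_trans[OF norm_le_sum_entries] sum_mono)
      then show "norm (DF x' v - DF x v) \<le> B x' * norm v"
        by (simp add: B_def sum_distrib_right)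
    qed
    ultimately show "\<forall>\<^sub>F x' in nhds x. onorm (\<lambda>v. DF x' v - DF x v) < e"
      by (auto elim!: eventually_mono intro: le_less_trans)
  qed
qed

lemma locally_injective:
  obtains H where "entry_polynomial H"
    and "\<And>x f'. q x \<noteq> 0 \<Longrightarrow> (F has_derivative f') (at x) \<Longrightarrow> inj f' \<Longrightarrow> H x \<noteq> 0"
    and "\<And>x. q x \<noteq> 0 \<Longrightarrow> H x \<noteq> 0 \<Longrightarrow> \<exists>r>0. inj_on F (ball x r)"
    and "\<And>x T. q x \<noteq> 0 \<Longrightarrow> H x \<noteq> 0 \<Longrightarrow> T \<subseteq> {x. q x \<noteq> 0} \<Longrightarrow> x \<in> interior T \<Longrightarrow>
      F x \<in> interior (F ` T)"
proof -
  obtain H DF where H: "entry_polynomial H"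
    and der: "\<And>x. q x \<noteq> 0 \<Longrightarrow> (F has_derivative DF x) (at x)"
    and inj: "\<And>x. q x \<noteq> 0 \<Longrightarrow> H x \<noteq> 0 \<longleftrightarrow> inj (DF x)"
    and cont: "\<And>x e. q x \<noteq> 0 \<Longrightarrow> e > 0 \<Longrightarrow> \<forall>\<^sub>F x' in nhds x. onorm (\<lambda>v. DF x' v - DF x v) < e"
    using jacobian by blast
  show thesis
  proof
    show "entry_polynomial H" by fact
    show "H x \<noteq> 0" if "q x \<noteq> 0" "(F has_derivative f') (at x)" "inj f'" for x f'
      using inj[OF that(1)] has_derivative_unique[OF that(2) der[OF that(1)]] that(3) by simp
    show "F x \<in> interior (F ` T)"
      if "q x \<noteq> 0" "H x \<noteq> 0" "T \<subseteq> {x. q x \<noteq> 0}" "x \<in> interior T" for x T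
      using open_at_injective_derivative[OF open_domain continuous_on_F _ der[OF that(1)]]
        inj[OF that(1)] that by simp
    fix x assume x: "q x \<noteq> 0" "H x \<noteq> 0"
    have lin: "linear (DF x)" using der[OF x(1)] has_derivative_linear by blast
    obtain g where g: "linear g" "g \<circ> DF x = id"
      using eucl.linear_injective_isomorphism[OF lin] inj[OF x(1)] x(2) by (auto simp: fun_eq_iff)
    show "\<exists>r>0. inj_on F (ball x r)"
    proof (rule has_derivative_locally_injective[where a = x and S = "{x. q x \<noteq> 0}" and f = F and f' = DF and g' = g])
      show "\<exists>d>0. \<forall>x'. dist x x' < d \<longrightarrow> onorm (\<lambda>v. DF x' v - DF x v) < e" if "e > 0" for e
        using cont[OF x(1) that] by (simp add: eventually_nhds_metric dist_commute)
    qed (use x g der open_domain in \<open>auto simp: linear_conv_bounded_linear\<close>)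
  qed
qed

text \<open>The polynomial p is the product of three kinds of conditions: entries of preimages stay
  bounded, 1 / q stays bounded on preimages, and the Jacobian determinant vanishes nowhere on the
  fibre. The bound on preimages is kept in the conclusion because it later shows that the ML-fibre
  consists of true inverses.\<close>

theorem generic_fibre:
  assumes "q x0 \<noteq> 0" "(F has_derivative f') (at x0)" "inj f'"
  shows "\<exists>p d. entry_polynomial p \<and> (\<exists>y. p y \<noteq> 0) \<and>
    (\<forall>y. p y \<noteq> 0 \<longrightarrow> finite {x. q x \<noteq> 0 \<and> F x = y} \<and> card {x. q x \<noteq> 0 \<and> F x = y} = d \<and>
      (\<exists>C. \<forall>\<^sub>F y' in nhds y. \<forall>x. q x \<noteq> 0 \<and> F x = y' \<longrightarrow> norm x \<le> C))"
proof -
  obtain H where H: "entry_polynomial H"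
    and Hx: "\<And>x f'. q x \<noteq> 0 \<Longrightarrow> (F has_derivative f') (at x) \<Longrightarrow> inj f' \<Longrightarrow> H x \<noteq> 0"
    and linj: "\<And>x. q x \<noteq> 0 \<Longrightarrow> H x \<noteq> 0 \<Longrightarrow> \<exists>r>0. inj_on F (ball x r)"
    and lop: "\<And>x T. q x \<noteq> 0 \<Longrightarrow> H x \<noteq> 0 \<Longrightarrow> T \<subseteq> {x. q x \<noteq> 0} \<Longrightarrow> x \<in> interior T \<Longrightarrow>
      F x \<in> interior (F ` T)"
    by (rule locally_injective) (rule that)
  have Hx0: "H x0 \<noteq> 0" using Hx assms by blast
  obtain pH where pH: "entry_polynomial pH" "\<exists>y. pH y \<noteq> 0"
    "\<And>x. q x \<noteq> 0 \<Longrightarrow> pH (F x) \<noteq> 0 \<Longrightarrow> H x \<noteq> 0"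
    using nonvanishing_on_fibres[OF H Hx0] by blast
  \<comment> \<open>The entry of x is written with numerator and denominator multiplied by q, to
    have the form H / q for which fibres were bounded.\<close>
  let ?P = "\<lambda>i j p. entry_polynomial p \<and> (\<exists>y. p y \<noteq> 0) \<and> (\<forall>y. p y \<noteq> 0 \<longrightarrow>
      (\<exists>C. \<forall>\<^sub>F y' in nhds y. \<forall>x. q x \<noteq> 0 \<and> F x = y' \<longrightarrow> norm (x $ i $ j * q x / q x) \<le> C))"
  define pc where "pc i j = (SOME p. ?P i j p)" for i j
  have "?P i j (pc i j)" for i j
    unfolding pc_def
    by (rule someI_ex[OF bounded_on_fibres[OF entry_polynomial.mult[OF entry_polynomial.entry q]]])
  then have pc: "entry_polynomial (pc i j)" "\<exists>y. pc i j y \<noteq> 0"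
    and bc: "pc i j y \<noteq> 0 \<Longrightarrow>
      \<exists>C. \<forall>\<^sub>F y' in nhds y. \<forall>x. q x \<noteq> 0 \<and> F x = y' \<longrightarrow> norm (x $ i $ j) \<le> C" for i j y
    by (simp_all cong: conj_cong)
  obtain pq where pq: "entry_polynomial pq" "\<exists>y. pq y \<noteq> 0"
    and bq: "\<And>y. pq y \<noteq> 0 \<Longrightarrow>
      \<exists>C. \<forall>\<^sub>F y' in nhds y. \<forall>x. q x \<noteq> 0 \<and> F x = y' \<longrightarrow> norm (1 / q x) \<le> C"
    using bounded_on_fibres[OF entry_polynomial.const[of 1]] by blast
  define pe where "pe y = (\<Prod>ij\<in>UNIV. pc (fst ij) (snd ij) y)" for y
  have pe: "entry_polynomial pe" "\<exists>y. pe y \<noteq> 0"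
    unfolding pe_def using pc by (auto intro!: entry_polynomial_prod entry_polynomial_prod_nonzero
        simp del: prod_zero_iff)
  define p where "p y = pe y * pq y * pH y" for y
  have p: "entry_polynomial p"
    unfolding p_def by (intro entry_polynomial.mult pe pq pH)
  have "\<exists>y. pe y * pq y \<noteq> 0"
    using pe(2) pq(2) entry_polynomial_mult_nonzero[OF pe(1) pq(1)] by blast
  then have ex_p: "\<exists>y. p y \<noteq> 0"
    using pH(2) entry_polynomial_mult_nonzero[OF entry_polynomial.mult[OF pe(1) pq(1)] pH(1)]
    unfolding p_def by blast
  let ?f = "\<lambda>y. {x. q x \<noteq> 0 \<and> F x = y}"
  have bounded: "\<exists>C. \<forall>\<^sub>F y' in nhds y. \<forall>x. q x \<noteq> 0 \<and> F x = y' \<longrightarrow> norm x \<le> C" if "p y \<noteq> 0" for y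
  proof -
    have "pc i j y \<noteq> 0" for i j using that by (force simp: p_def pe_def)
    then have "\<exists>C. \<forall>\<^sub>F y' in nhds y. \<forall>x. q x \<noteq> 0 \<and> F x = y' \<longrightarrow> norm (x $ i $ j) \<le> C" for i j
      using bc by blast
    note ex_C = this
    define C where "C i j = (SOME C. \<forall>\<^sub>F y' in nhds y. \<forall>x. q x \<noteq> 0 \<and> F x = y' \<longrightarrow> norm (x $ i $ j) \<le> C)"
      for i j
    have C: "\<forall>\<^sub>F y' in nhds y. \<forall>x. q x \<noteq> 0 \<and> F x = y' \<longrightarrow> norm (x $ i $ j) \<le> C i j" for i j
      unfolding C_def by (rule someI_ex[OF ex_C])
    have "\<forall>\<^sub>F y' in nhds y. \<forall>i j. \<forall>x. q x \<noteq> 0 \<and> F x = y' \<longrightarrow> norm (x $ i $ j) \<le> C i j"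
      by (intro eventually_all_finite C)
    then have "\<forall>\<^sub>F y' in nhds y. \<forall>x. q x \<noteq> 0 \<and> F x = y' \<longrightarrow> norm x \<le> (\<Sum>i\<in>UNIV. \<Sum>j\<in>UNIV. C i j)"
      by eventually_elim (auto intro!: order_trans[OF norm_le_sum_entries] sum_mono)
    then show ?thesis by blast
  qed
  have loc: "finite (?f y) \<and> (\<forall>\<^sub>F y' in nhds y. card (?f y') = card (?f y))" if y: "p y \<noteq> 0" for y
  proof -
    obtain C where C: "\<forall>\<^sub>F y' in nhds y. \<forall>x. q x \<noteq> 0 \<and> F x = y' \<longrightarrow> norm x \<le> C"
      using bounded[OF y] by blast
    obtain D where D: "\<forall>\<^sub>F y' in nhds y. \<forall>x. q x \<noteq> 0 \<and> F x = y' \<longrightarrow> norm (1 / q x) \<le> D"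
      using bq y by (auto simp: p_def)
    \<comment> \<open>The bound on 1 / q keeps K away from the zeros of q, so K is a compact subset
      of the domain of F.\<close>
    define K where "K = cball 0 C \<inter> {x. 1 \<le> D * norm (q x)}"
    have "closed {x. 1 \<le> D * norm (q x)}"
      by (intro closed_Collect_le continuous_intros entry_polynomial_continuous_on q)
    then have cK: "compact K" unfolding K_def by (intro compact_Int_closed compact_cball)
    have pK: "\<forall>\<^sub>F y' in nhds y. \<forall>x\<in>{x. q x \<noteq> 0}. F x = y' \<longrightarrow> x \<in> K"
      using C D
    proof eventually_elim
      case (elim y')
      then have "norm x \<le> C" "1 \<le> D * norm (q x)" if "q x \<noteq> 0" "F x = y'" for x
        using that by (auto simp: norm_divide field_simps)
      then show ?case by (auto simp: K_def)
    qed
    have KU: "K \<subseteq> {x. q x \<noteq> 0}" unfolding K_def by auto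
    have Hy: "H x \<noteq> 0" if "q x \<noteq> 0" "F x = y" for x
      using pH(3) that y by (auto simp: p_def)
    have inj_y: "\<exists>r>0. inj_on F (ball x r)" if "x \<in> {x. q x \<noteq> 0}" "F x = y" for x
      using linj[of x] Hy[of x] that by simp
    have op_y: "y \<in> interior (F ` ball x r)"
      if "x \<in> {x. q x \<noteq> 0}" "F x = y" "r > 0" "ball x r \<subseteq> {x. q x \<noteq> 0}" for x r
      using lop[of x "ball x r"] Hy[of x] that by (simp add: interior_open)
    have "finite {x \<in> {x. q x \<noteq> 0}. F x = y}"
      by (rule fibre_card_locally_constant(1)[where y = y, OF open_domain continuous_on_F _ _ cK KU pK])
        (erule (1) inj_y, erule (3) op_y)
    moreover have "\<forall>\<^sub>F y' in nhds y. finite {x \<in> {x. q x \<noteq> 0}. F x = y'} \<and>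
        card {x \<in> {x. q x \<noteq> 0}. F x = y'} = card {x \<in> {x. q x \<noteq> 0}. F x = y}"
      by (rule fibre_card_locally_constant(2)[where y = y, OF open_domain continuous_on_F _ _ cK KU pK])
        (erule (1) inj_y, erule (3) op_y)
    ultimately show ?thesis by (auto elim: eventually_mono)
  qed
  obtain y0 where y0: "p y0 \<noteq> 0" using ex_p by blast
  have "card (?f y) = card (?f y0)" if y: "p y \<noteq> 0" for y
  proof -
    define S where "S = - {s. p (mat_line y0 y s) = 0}"
    have "countable {s. p (mat_line y0 y s) = 0}"
      using finite_zeros_mat_line[OF p, of y0 y] y by (simp add: countable_finite)
    then have "connected S"
      unfolding S_def by (intro path_connected_imp_connected path_connected_complement_countable) auto
    then have "(\<lambda>s. card (?f (mat_line y0 y s))) constant_on S"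
    proof (rule locally_constant_imp_constant)
      fix s assume "s \<in> S"
      then have "\<forall>\<^sub>F y' in nhds (mat_line y0 y s). card (?f y') = card (?f (mat_line y0 y s))"
        using loc by (simp add: S_def)
      then obtain T where T: "open T" "mat_line y0 y s \<in> T"
        "\<And>y'. y' \<in> T \<Longrightarrow> card (?f y') = card (?f (mat_line y0 y s))"
        unfolding eventually_nhds by blast
      have "openin (top_of_set S) (S \<inter> mat_line y0 y -` T)"
        using T(1) continuous_on_mat_line by (blast intro: continuous_openin_preimage_gen)
      then show "\<exists>T. openin (top_of_set S) T \<and> s \<in> T \<and>
          (\<forall>x\<in>T. card (?f (mat_line y0 y x)) = card (?f (mat_line y0 y s)))"
      proof (intro exI conjI ballI)
        show "s \<in> S \<inter> mat_line y0 y -` T" using T(2) \<open>s \<in> S\<close> by simp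
        fix s' assume "s' \<in> S \<inter> mat_line y0 y -` T"
        then show "card (?f (mat_line y0 y s')) = card (?f (mat_line y0 y s))"
          by (intro T(3)) simp
      qed
    qed
    then obtain c where "\<And>s. s \<in> S \<Longrightarrow> card (?f (mat_line y0 y s)) = c"
      unfolding constant_on_def by blast
    from this[of 0] this[of 1] show ?thesis using y y0 by (simp add: S_def)
  qed
  with p ex_p loc bounded show ?thesis by blast
qed

end

section \<open>The ML-degree of a graph\<close>

lemma entry_polynomial_compose:
  assumes "entry_polynomial p" "\<And>i j. entry_polynomial (\<lambda>M. \<Phi> M $ i $ j)"
  shows "entry_polynomial (\<lambda>M. p (\<Phi> M))"
  using assms(1) by induction (auto intro: entry_polynomial.intros assms(2))

section \<open>Inverse matrices as rational functions\<close>

lemma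
  fixes A :: "complex ^ 'n ^ 'n"
  assumes "invertible A"
  shows matrix_inv_right: "A ** matrix_inv A = mat 1"
    and matrix_inv_left: "matrix_inv A ** A = mat 1"
  using someI_ex[OF assms[unfolded invertible_def]] by (auto simp: matrix_inv_def)

text \<open>Cramer's determinants for the system with right-hand side the unit vector l, whose
  solution is column l of the inverse times the determinant.\<close>

definition adjugate :: "complex ^ 'n ^ 'n \<Rightarrow> complex ^ 'n ^ 'n" where
  "adjugate A = (\<chi> k l. det (\<chi> i j. if j = k then axis l 1 $ i else A $ i $ j))"

lemma matrix_inv_entry:
  assumes "det A \<noteq> 0"
  shows "matrix_inv A $ k $ l = adjugate A $ k $ l / det A"
proof -
  have "A ** matrix_inv A = mat 1"
    using assms by (intro matrix_inv_right) (simp add: invertible_det_nz)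
  moreover have "A *v column l (matrix_inv A) = column l (A ** matrix_inv A)"
    by (simp add: vec_eq_iff column_def matrix_vector_mult_def matrix_matrix_mult_def)
  ultimately have "A *v column l (matrix_inv A) = axis l 1"
    by (simp add: vec_eq_iff column_def mat_def axis_def)
  then have "column l (matrix_inv A) =
      (\<chi> k. det (\<chi> i j. if j = k then axis l 1 $ i else A $ i $ j) / det A)"
    using cramer[OF assms] by blast
  then have "column l (matrix_inv A) $ k = adjugate A $ k $ l / det A"
    by (simp add: adjugate_def)
  then show ?thesis by (simp add: column_def)
qed

lemma entry_polynomial_adjugate: "entry_polynomial (\<lambda>A. adjugate A $ k $ l)"
  unfolding adjugate_def vec_lambda_beta
  by (intro entry_polynomial_det) (auto simp: vec_lambda_beta intro: entry_polynomial_intros)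

lemma continuous_on_matrix_inv: "continuous_on {A. det A \<noteq> 0} (matrix_inv :: complex ^ 'n ^ 'n \<Rightarrow> _)"
proof -
  have "continuous_on {A. det A \<noteq> 0} (\<lambda>A. \<chi> k l. adjugate A $ k $ l / det A)"
    by (intro continuous_on_vec_lambda continuous_on_divide entry_polynomial_continuous_on
        entry_polynomial_adjugate entry_polynomial_det entry_polynomial.entry) auto
  then show ?thesis
    by (rule continuous_on_eq) (simp add: vec_eq_iff matrix_inv_entry)
qed

lemma open_det_nonzero: "open {A :: complex ^ 'n ^ 'n. det A \<noteq> 0}"
  by (intro open_entry_polynomial_nonzero entry_polynomial_det entry_polynomial.entry)

lemma tendsto_matrix_mult:
  fixes A B :: "'a \<Rightarrow> complex ^ 'n ^ 'n"
  assumes "(A \<longlongrightarrow> a) F" "(B \<longlongrightarrow> b) F"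
  shows "((\<lambda>x. A x ** B x) \<longlongrightarrow> a ** b) F"
  unfolding matrix_matrix_mult_def
  by (intro vec_tendstoI) (auto intro!: tendsto_intros assms)

lemma matrix_inv_unique:
  fixes A B :: "complex ^ 'n ^ 'n"
  assumes "A ** B = mat 1"
  shows "invertible A" "matrix_inv A = B"
proof -
  show "invertible A" using assms invertible_right_inverse by blast
  then show "matrix_inv A = B"
    by (metis assms matrix_inv_left matrix_mul_assoc matrix_mul_lid matrix_mul_rid)
qed

lemma matrix_inv_inv:
  fixes A :: "complex ^ 'n ^ 'n"
  assumes "invertible A"
  shows "invertible (matrix_inv A)" "matrix_inv (matrix_inv A) = A"
  using matrix_inv_unique[OF matrix_inv_left[OF assms]] by auto

lemma sym_mats_matrix_inv:
  fixes A :: "complex ^ 'n ^ 'n"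
  assumes "A \<in> sym_mats" "invertible A"
  shows "matrix_inv A \<in> sym_mats"
proof -
  have "A ** transpose (matrix_inv A) = transpose (matrix_inv A ** A)"
    using assms(1) by (simp add: sym_mats_def matrix_transpose_mul)
  then have "A ** transpose (matrix_inv A) = mat 1"
    by (simp add: matrix_inv_left[OF assms(2)] transpose_mat)
  then show ?thesis
    using matrix_inv_unique(2)[of A "transpose (matrix_inv A)"] by (simp add: sym_mats_def)
qed

section \<open>Symmetric matrices and the projection to the graph space\<close>

lemma mem_sym_mats: "M \<in> sym_mats \<longleftrightarrow> (\<forall>i j. M $ i $ j = M $ j $ i)"
  by (auto simp: sym_mats_def transpose_def vec_eq_iff)

text \<open>A polynomial retraction onto the symmetric matrices; composing with it turns a
  polynomial condition on symmetric matrices into one on all matrices.\<close>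

definition symmetrize :: "complex ^ 'n ^ 'n \<Rightarrow> complex ^ 'n ^ 'n" where
  "symmetrize M = (\<chi> i j. (M $ i $ j + M $ j $ i) / 2)"

lemma symmetrize_sym [simp]: "symmetrize M \<in> sym_mats"
  by (simp add: mem_sym_mats symmetrize_def add.commute)

lemma symmetrize_id: "M \<in> sym_mats \<Longrightarrow> symmetrize M = M"
  by (auto simp: mem_sym_mats symmetrize_def vec_eq_iff)

lemma entry_polynomial_half: "entry_polynomial p \<Longrightarrow> entry_polynomial (\<lambda>M. p M / 2)"
  using entry_polynomial.mult[OF _ entry_polynomial.const[of "1/2"]] by fastforce

lemma entry_polynomial_symmetrize: "entry_polynomial (\<lambda>M. symmetrize M $ i $ j)"
  unfolding symmetrize_def vec_lambda_beta
  by (intro entry_polynomial_half entry_polynomial.intros)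

text \<open>On all matrices this is the orthogonal projection for the trace form; its kernel
  contains the antisymmetric matrices.\<close>

definition graph_proj :: "'n::finite set set \<Rightarrow> complex ^ 'n ^ 'n \<Rightarrow> complex ^ 'n ^ 'n" where
  "graph_proj E M = (\<chi> i j. if i = j \<or> {i, j} \<in> E then (M $ i $ j + M $ j $ i) / 2 else 0)"

lemma graph_proj_space [simp]: "graph_proj E M \<in> graph_space E"
  by (auto simp: graph_space_def mem_sym_mats graph_proj_def insert_commute add.commute)

lemma graph_proj_id: "M \<in> graph_space E \<Longrightarrow> graph_proj E M = M"
  by (auto simp: graph_space_def mem_sym_mats graph_proj_def vec_eq_iff)

lemma graph_proj_idem [simp]: "graph_proj E (graph_proj E M) = graph_proj E M"
  by (simp add: graph_proj_id)

lemma linear_graph_proj: "linear (graph_proj E)"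
  by (rule linearI) (auto simp: graph_proj_def vec_eq_iff field_simps scaleR_conv_of_real[where 'a = complex])

lemmas graph_proj_simps = linear_add[OF linear_graph_proj] linear_diff[OF linear_graph_proj]
  linear_scale[OF linear_graph_proj] linear_neg[OF linear_graph_proj] linear_0[OF linear_graph_proj]

lemma tendsto_graph_proj: "(f \<longlongrightarrow> a) net \<Longrightarrow> ((\<lambda>x. graph_proj E (f x)) \<longlongrightarrow> graph_proj E a) net"
  using linear_graph_proj[of E] by (metis bounded_linear.tendsto linear_conv_bounded_linear)

lemma entry_polynomial_graph_proj: "entry_polynomial (\<lambda>M. graph_proj E M $ i $ j)"
  unfolding graph_proj_def vec_lambda_beta
  by (intro entry_polynomial_if entry_polynomial_half entry_polynomial.intros)

lemma mat_1_graph_space: "mat 1 \<in> graph_space E"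
  by (auto simp: graph_space_def mem_sym_mats mat_def)

lemma graph_space_subset_sym: "graph_space E \<subseteq> sym_mats"
  by (auto simp: graph_space_def)

lemma graph_space_perp_iff:
  "A \<in> graph_space_perp E \<longleftrightarrow> A \<in> sym_mats \<and> graph_proj E A = 0"
proof (cases "A \<in> sym_mats")
  case True
  have tr: "trace (A ** M) = (\<Sum>i\<in>UNIV. \<Sum>j\<in>UNIV. A $ i $ j * M $ j $ i)" for M
    by (simp add: trace_def matrix_matrix_mult_def)
  have sym: "A $ i $ j = A $ j $ i" for i j using True by (simp add: mem_sym_mats)
  have "(\<forall>M \<in> graph_space E. trace (A ** M) = 0) \<longleftrightarrow> graph_proj E A = 0"
  proof
    assume *: "\<forall>M \<in> graph_space E. trace (A ** M) = 0"
    have "A $ k $ l = 0" if "k = l \<or> {k, l} \<in> E" for k l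
    proof -
      \<comment> \<open>M tests the entry (k, l). It is a sum of two elementary matrices, and twice
        a single one if k = l, so the trace equals twice the entry in both cases.\<close>
      define M :: "complex ^ 'a ^ 'a" where
        "M = (\<chi> i j. (if i = l \<and> j = k then 1 else 0) + (if i = k \<and> j = l then 1 else 0))"
      have "M $ i $ j = M $ j $ i" for i j by (simp add: M_def conj_commute)
      then have "M \<in> sym_mats" by (auto simp only: mem_sym_mats)
      moreover have "M $ i $ j = 0" if "i \<noteq> j" "{i, j} \<notin> E" for i j
      proof -
        have "\<not> (i = l \<and> j = k)" "\<not> (i = k \<and> j = l)"
          using that \<open>k = l \<or> {k, l} \<in> E\<close> by (metis insert_commute)+
        then show ?thesis unfolding M_def by (simp only: vec_lambda_beta if_False) simp
      qed
      ultimately have "M \<in> graph_space E" unfolding graph_space_def by blast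
      then have "0 = trace (A ** M)" using * by simp
      also have "\<dots> = (\<Sum>i\<in>UNIV. \<Sum>j\<in>UNIV. (if j = l then if i = k then A $ k $ l else 0 else 0) +
          (if j = k then if i = l then A $ l $ k else 0 else 0))"
        unfolding tr by (intro sum.cong refl) (auto simp: M_def)
      also have "\<dots> = 2 * A $ k $ l" using sym[of k l] by (simp add: sum.distrib)
      finally show ?thesis by simp
    qed
    then show "graph_proj E A = 0"
      by (auto simp: graph_proj_def vec_eq_iff insert_commute)
  next
    assume *: "graph_proj E A = 0"
    have 0: "A $ i $ j = 0" if "i = j \<or> {i, j} \<in> E" for i j
      using arg_cong[OF *, of "\<lambda>M. M $ i $ j"] that sym[of i j] by (auto simp: graph_proj_def)
    show "\<forall>M \<in> graph_space E. trace (A ** M) = 0"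
    proof
      fix M assume M: "M \<in> graph_space E"
      have "A $ i $ j * M $ j $ i = 0" for i j
        using 0[of i j] M by (cases "i = j \<or> {i, j} \<in> E") (auto simp: graph_space_def insert_commute)
      then show "trace (A ** M) = 0" unfolding tr by (intro sum.neutral ballI)
    qed
  qed
  with True show ?thesis by (simp add: graph_space_perp_def)
qed (simp add: graph_space_perp_def)

lemma graph_space_inv_sym:
  fixes E :: "'n::finite set set"
  shows "graph_space_inv E \<subseteq> sym_mats"
  unfolding graph_space_inv_def
proof (rule closure_minimal)
  show "matrix_inv ` {M \<in> graph_space E. invertible M} \<subseteq> sym_mats"
    using graph_space_subset_sym sym_mats_matrix_inv by blast
  have *: "(sym_mats :: (complex ^ 'n ^ 'n) set) = (\<Inter>i. \<Inter>j. {M. M $ i $ j = M $ j $ i})"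
    by (auto simp: mem_sym_mats)
  show "closed (sym_mats :: (complex ^ 'n ^ 'n) set)"
    unfolding * by (intro closed_INT ballI closed_Collect_eq continuous_intros)
qed

lemma ml_fibre_eq:
  assumes S: "S \<in> sym_mats"
  shows "ml_fibre E S = {X \<in> graph_space_inv E. graph_proj E X = graph_proj E S}"
proof -
  have "X - S \<in> sym_mats" if "X \<in> graph_space_inv E" for X
    using subsetD[OF graph_space_inv_sym that] S unfolding mem_sym_mats
    by (metis vector_minus_component)
  then have "X - S \<in> graph_space_perp E \<longleftrightarrow> graph_proj E X = graph_proj E S"
    if "X \<in> graph_space_inv E" for X
    using that by (simp add: graph_space_perp_iff graph_proj_simps)
  moreover have "X \<in> {S + A | A. A \<in> graph_space_perp E} \<longleftrightarrow> X - S \<in> graph_space_perp E" for X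
    by (auto intro: exI[of _ "X - S"])
  ultimately show ?thesis unfolding ml_fibre_def by blast
qed

lemma matrix_inv_in_ml_fibre:
  assumes "S \<in> sym_mats" "K \<in> graph_space E" "invertible K"
    and "graph_proj E (matrix_inv K) = graph_proj E S"
  shows "matrix_inv K \<in> ml_fibre E S"
  using assms closure_subset[of "matrix_inv ` {M \<in> graph_space E. invertible M}"]
  by (auto simp: ml_fibre_eq graph_space_inv_def)

text \<open>
  On the graph space this is inversion followed by projection, and it is the identity in the
  complementary directions. Thus the fibres of the projection of \<open>L\<^sub>G\<^sup>-\<^sup>1\<close> become fibres of a rational map of
  the whole matrix space to itself.
\<close>

definition completion_map :: "'n::finite set set \<Rightarrow> complex ^ 'n ^ 'n \<Rightarrow> complex ^ 'n ^ 'n" where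
  "completion_map E x = graph_proj E (matrix_inv (graph_proj E x)) + x - graph_proj E x"

definition completion_num :: "'n::finite set set \<Rightarrow> complex ^ 'n ^ 'n \<Rightarrow> complex ^ 'n ^ 'n" where
  "completion_num E x = (\<chi> i j. graph_proj E (adjugate (graph_proj E x)) $ i $ j +
    det (graph_proj E x) * (x $ i $ j - graph_proj E x $ i $ j))"

lemma completion_rational:
  "rational_matrix_map (completion_num E) (\<lambda>x. det (graph_proj E x))"
proof
  have proj: "entry_polynomial (\<lambda>x. graph_proj E x $ i $ j)" for i j
    by (rule entry_polynomial_graph_proj)
  show "entry_polynomial (\<lambda>x. det (graph_proj E x))"
    by (intro entry_polynomial_det proj)
  have adj: "entry_polynomial (\<lambda>x. graph_proj E (adjugate (graph_proj E x)) $ i $ j)" for i j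
    by (intro entry_polynomial_compose[OF proj, of "\<lambda>x. adjugate (graph_proj E x)"]
        entry_polynomial_compose[OF entry_polynomial_adjugate] proj)
  show "entry_polynomial (\<lambda>x. completion_num E x $ i $ j)" for i j
    unfolding completion_num_def vec_lambda_beta
    by (intro entry_polynomial_intros adj proj)
qed

lemma completion_map_eq:
  assumes "det (graph_proj E x) \<noteq> 0"
  shows "rational_matrix_map.F (completion_num E) (\<lambda>x. det (graph_proj E x)) x = completion_map E x"
proof -
  interpret rational_matrix_map "completion_num E" "\<lambda>x. det (graph_proj E x)"
    by (rule completion_rational)
  have "graph_proj E (adjugate (graph_proj E x)) $ i $ j / det (graph_proj E x) =
      graph_proj E (matrix_inv (graph_proj E x)) $ i $ j" for i j
    using assms by (simp add: graph_proj_def[of E "adjugate _"] graph_proj_def[of E "matrix_inv _"]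
        matrix_inv_entry add_divide_distrib mult.commute)
  then show ?thesis
    using assms by (simp add: F_def completion_num_def completion_map_def vec_eq_iff add_divide_distrib
        diff_divide_distrib)
qed

lemma tendsto_matrix_inv:
  fixes A :: "'a \<Rightarrow> complex ^ 'n ^ 'n"
  assumes "(A \<longlongrightarrow> a) net" "det a \<noteq> 0"
  shows "((\<lambda>x. matrix_inv (A x)) \<longlongrightarrow> matrix_inv a) net"
proof -
  have "isCont (matrix_inv :: complex ^ 'n ^ 'n \<Rightarrow> _) a"
    using continuous_on_matrix_inv assms(2)
    unfolding continuous_on_eq_continuous_at[OF open_det_nonzero] by blast
  then show ?thesis using assms(1) by (rule isCont_tendsto_compose)
qed

text \<open>
  Writing \<open>K = 1 + s P h\<close> with \<open>P\<close> the projection, \<open>K\<^sup>-\<^sup>1 = 1 - s (P h) K\<^sup>-\<^sup>1\<close>, so the derivative of the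
  completion map at the identity is \<open>h \<mapsto> h - 2 P h\<close>.
\<close>

lemma completion_map_derivative_inj:
  assumes D: "(completion_map E has_derivative f') (at (mat 1))"
  shows "inj f'"
proof -
  have lin: "linear f'" using D has_derivative_linear by blast
  have det1: "det (mat 1 :: complex ^ 'n ^ 'n) \<noteq> 0" by simp
  have "f' h = h - 2 *\<^sub>R graph_proj E h" for h
  proof -
    let ?P = "graph_proj E"
    have P1: "?P (mat 1) = mat 1" by (rule graph_proj_id[OF mat_1_graph_space])
    define K where "K s = mat 1 + s *\<^sub>R ?P h" for s :: real
    have K: "?P (mat 1 + s *\<^sub>R h) = K s" for s
      by (simp add: K_def graph_proj_simps P1)
    have Klim: "(K \<longlongrightarrow> mat 1) (at 0)"
      unfolding K_def by (rule tendsto_eq_intros refl)+ simp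
    have ev: "\<forall>\<^sub>F s in at 0. det (K s) \<noteq> 0"
      using topological_tendstoD[OF Klim open_det_nonzero] by simp
    have inv1: "matrix_inv (mat 1) = (mat 1 :: complex ^ 'a ^ 'a)"
      by (rule matrix_inv_unique) simp
    have "((\<lambda>s. matrix_inv (K s)) \<longlongrightarrow> mat 1) (at 0)"
      using tendsto_matrix_inv[OF Klim] by (simp add: inv1)
    then have "((\<lambda>s. h - ?P h - ?P (?P h ** matrix_inv (K s))) \<longlongrightarrow> h - ?P h - ?P (?P h ** mat 1)) (at 0)"
      by (intro tendsto_diff tendsto_const tendsto_graph_proj tendsto_matrix_mult)
    moreover have "\<forall>\<^sub>F s in at 0. h - ?P h - ?P (?P h ** matrix_inv (K s)) =
        (completion_map E (mat 1 + s *\<^sub>R h) - completion_map E (mat 1)) /\<^sub>R s"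
      using ev eventually_neq_at_within[of "0::real" 0 UNIV]
    proof eventually_elim
      case (elim s)
      have "mat 1 = K s ** matrix_inv (K s)"
        using elim(1) by (simp add: matrix_inv_right invertible_det_nz)
      also have "\<dots> = matrix_inv (K s) + s *\<^sub>R (?P h ** matrix_inv (K s))"
      proof -
        have "(A + s *\<^sub>R B) ** C = A ** C + s *\<^sub>R (B ** C)" for A B C :: "complex ^ 'a ^ 'a"
          by (simp add: matrix_matrix_mult_def vec_eq_iff distrib_right sum.distrib scaleR_sum_right)
        then show ?thesis by (simp add: K_def)
      qed
      finally have "matrix_inv (K s) = mat 1 - s *\<^sub>R (?P h ** matrix_inv (K s))"
        by (simp add: eq_diff_eq)
      then have "?P (matrix_inv (K s)) = mat 1 - s *\<^sub>R ?P (?P h ** matrix_inv (K s))"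
        by (metis P1 graph_proj_simps(2,3))
      then have "completion_map E (mat 1 + s *\<^sub>R h) - completion_map E (mat 1) =
          s *\<^sub>R (h - ?P h - ?P (?P h ** matrix_inv (K s)))"
        by (simp add: completion_map_def K P1 inv1 K_def[of s] scaleR_diff_right algebra_simps)
      then show ?case using elim(2) by simp
    qed
    ultimately have "((\<lambda>s. (completion_map E (mat 1 + s *\<^sub>R h) - completion_map E (mat 1)) /\<^sub>R s)
        \<longlongrightarrow> h - ?P h - ?P (?P h ** mat 1)) (at 0)"
      by (rule Lim_transform_eventually)
    moreover have "((\<lambda>s. (completion_map E (mat 1 + s *\<^sub>R h) - completion_map E (mat 1)) /\<^sub>R s)
        \<longlongrightarrow> f' h) (at 0)"
    proof -
      have "((\<lambda>s. completion_map E (mat 1 + s *\<^sub>R h)) has_derivative (\<lambda>s. f' (s *\<^sub>R h))) (at 0)"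
        by (rule has_derivative_compose[where g = "completion_map E", OF _ , unfolded o_def])
          (auto intro!: derivative_eq_intros simp: D)
      then have "((\<lambda>s. completion_map E (mat 1 + s *\<^sub>R h)) has_vector_derivative f' h) (at 0)"
        by (simp add: has_vector_derivative_def linear_scale[OF lin])
      note der0 = this[unfolded has_vector_derivative_def has_derivative_at, THEN conjunct2]
      have "((\<lambda>s. norm ((completion_map E (mat 1 + s *\<^sub>R h) - completion_map E (mat 1)) /\<^sub>R s - f' h))
          \<longlongrightarrow> 0) (at 0)"
      proof (rule Lim_transform_eventually[OF der0])
        show "\<forall>\<^sub>F s in at 0. norm (completion_map E (mat 1 + (0 + s) *\<^sub>R h) - completion_map E (mat 1 + 0 *\<^sub>R h) -
            s *\<^sub>R f' h) / norm s =
          norm ((completion_map E (mat 1 + s *\<^sub>R h) - completion_map E (mat 1)) /\<^sub>R s - f' h)"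
          using eventually_neq_at_within[of "0::real" 0 UNIV]
        proof eventually_elim
          case (elim s)
          have "norm (v - s *\<^sub>R f' h) / norm s = norm (v /\<^sub>R s - f' h)" for v
          proof -
            have "v /\<^sub>R s - f' h = (v - s *\<^sub>R f' h) /\<^sub>R s"
              using elim by (simp add: scaleR_diff_right)
            then show ?thesis by (simp add: divide_inverse mult.commute)
          qed
          then show ?case by simp
        qed
      qed
      then show ?thesis
        by (rule LIM_zero_cancel[OF tendsto_norm_zero_cancel])
    qed
    ultimately have "h - ?P h - ?P (?P h ** mat 1) = f' h"
      by (intro tendsto_unique[OF at_neq_bot])
    then show ?thesis by (simp add: algebra_simps scaleR_2)
  qed
  moreover have "h = 0" if "h - 2 *\<^sub>R graph_proj E h = 0" for h
  proof -
    have "graph_proj E h = 2 *\<^sub>R graph_proj E h"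
      using arg_cong[OF that, of "graph_proj E"] by (simp add: graph_proj_simps)
    then show ?thesis using that by (simp add: scaleR_2)
  qed
  ultimately show ?thesis using linear_injective_0[OF lin] by simp
qed

section \<open>The ML-fibre as a fibre of the completion map\<close>

locale completion = fixes E :: "'n::finite set set"
begin

sublocale rational_matrix_map "completion_num E" "\<lambda>x. det (graph_proj E x)"
  by (rule completion_rational)

lemma F_eq: "det (graph_proj E x) \<noteq> 0 \<Longrightarrow> F x = completion_map E x"
  by (rule completion_map_eq)

lemma det_proj_1: "det (graph_proj E (mat 1)) \<noteq> 0"
  by (simp add: graph_proj_id[OF mat_1_graph_space])

lemma derivative_at_1: obtains f' where "(F has_derivative f') (at (mat 1))" "inj f'"
proof -
  obtain f' where f': "(F has_derivative f') (at (mat 1))"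
    using F_has_derivative[of thesis] det_proj_1 that by (metis jacobian)
  have "(completion_map E has_derivative f') (at (mat 1))"
    by (rule has_derivative_transform_within_open[OF f' open_domain])
      (use det_proj_1 F_eq in auto)
  then show thesis using that f' completion_map_derivative_inj by blast
qed

lemma completion_map_proj: "graph_proj E (completion_map E x) = graph_proj E (matrix_inv (graph_proj E x))"
  by (simp add: completion_map_def graph_proj_simps)

text \<open>T may differ from S in the kernel of the projection, which leaves the ML-fibre
  unchanged. The content is surjectivity: a point X of the closure is a limit of inverses of
  matrices \<open>K n\<close>; these extend to a sequence \<open>x n\<close> whose images tend to T,
  so it is eventually bounded. A subsequence converges to some \<open>l\<close>, and passing to the
  limit in the product of \<open>K n\<close> with its inverse shows that X is inverse to the
  projection of \<open>l\<close>.\<close>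

lemma bij_ml_fibre:
  assumes S: "S \<in> sym_mats" and T: "graph_proj E T = graph_proj E S"
    and bnd: "\<forall>\<^sub>F y in nhds T. \<forall>x. det (graph_proj E x) \<noteq> 0 \<and> F x = y \<longrightarrow> norm x \<le> C"
  shows "bij_betw (\<lambda>x. matrix_inv (graph_proj E x))
    {x. det (graph_proj E x) \<noteq> 0 \<and> F x = T} (ml_fibre E S)"
proof -
  let ?P = "graph_proj E"
  have surj: "\<exists>x. det (?P x) \<noteq> 0 \<and> F x = T \<and> X = matrix_inv (?P x)" if X: "X \<in> ml_fibre E S" for X
  proof -
    have PX: "?P X = ?P S" and "X \<in> graph_space_inv E"
      using X by (simp_all add: ml_fibre_eq[OF S])
    then obtain Y where Y: "\<And>n. Y n \<in> matrix_inv ` {M \<in> graph_space E. invertible M}" "Y \<longlonglongrightarrow> X"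
      unfolding graph_space_inv_def closure_sequential by blast
    have "\<forall>n. \<exists>K. K \<in> graph_space E \<and> invertible K \<and> Y n = matrix_inv K"
      using Y(1) by blast
    then obtain K where K: "\<And>n. K n \<in> graph_space E" "\<And>n. invertible (K n)" "\<And>n. Y n = matrix_inv (K n)"
      by metis
    have PK: "?P (K n) = K n" for n by (rule graph_proj_id[OF K(1)])
    \<comment> \<open>Supplies the component of T outside the graph space, which the completion map
      leaves alone.\<close>
    define x where "x n = T - ?P T + K n" for n
    have Px: "?P (x n) = K n" for n by (simp add: x_def graph_proj_simps PK)
    have dx: "det (?P (x n)) \<noteq> 0" for n using K(2) by (simp add: Px invertible_det_nz)
    have Fx: "F (x n) = ?P (Y n) + T - ?P T" for n
      using dx by (simp add: F_eq completion_map_def Px K(3)) (simp add: x_def)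
    have "(\<lambda>n. F (x n)) \<longlonglongrightarrow> ?P X + T - ?P T"
      unfolding Fx by (intro tendsto_intros tendsto_graph_proj Y(2))
    then have "(\<lambda>n. F (x n)) \<longlonglongrightarrow> T" by (simp add: PX T)
    then have "\<forall>\<^sub>F n in sequentially. \<forall>x'. det (?P x') \<noteq> 0 \<and> F x' = F (x n) \<longrightarrow> norm x' \<le> C"
      using bnd by (rule eventually_compose_filterlim[rotated])
    then obtain N where "\<And>n. n \<ge> N \<Longrightarrow> norm (x n) \<le> C"
      unfolding eventually_sequentially using dx by blast
    then have "\<forall>n. x (n + N) \<in> cball 0 C" by simp
    then obtain l r where r: "strict_mono r" "((\<lambda>n. x (n + N)) \<circ> r) \<longlonglongrightarrow> l"
      using compact_cball[of 0 C] unfolding compact_def by metis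
    define s where "s n = r n + N" for n
    have xs: "(\<lambda>n. x (s n)) \<longlonglongrightarrow> l" using r(2) by (simp add: o_def s_def)
    have "strict_mono s" using r(1) by (simp add: s_def strict_mono_def)
    then have Ys: "(\<lambda>n. Y (s n)) \<longlonglongrightarrow> X"
      using LIMSEQ_subseq_LIMSEQ[OF Y(2)] by (simp add: o_def)
    have "(\<lambda>n. ?P (x (s n)) ** Y (s n)) \<longlonglongrightarrow> ?P l ** X"
      by (intro tendsto_matrix_mult tendsto_graph_proj xs Ys)
    moreover have "?P (x (s n)) ** Y (s n) = mat 1" for n
      by (simp add: Px K(3) matrix_inv_right[OF K(2)])
    ultimately have "?P l ** X = mat 1" by (simp add: LIMSEQ_const_iff)
    then have inv: "invertible (?P l)" "matrix_inv (?P l) = X" by (rule matrix_inv_unique)+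
    define z where "z = T - ?P T + ?P l"
    have Pz: "?P z = ?P l" by (simp add: z_def graph_proj_simps)
    have dz: "det (?P z) \<noteq> 0" using inv(1) by (simp add: Pz invertible_det_nz)
    have "F z = T"
      using dz by (simp add: F_eq completion_map_def Pz inv(2) PX T) (simp add: z_def T)
    with dz show ?thesis using Pz inv(2) by metis
  qed
  show ?thesis
    unfolding bij_betw_def
  proof (intro conjI inj_onI set_eqI iffI)
    fix x x' assume x: "x \<in> {x. det (?P x) \<noteq> 0 \<and> F x = T}" and x': "x' \<in> {x. det (?P x) \<noteq> 0 \<and> F x = T}"
      and eq: "matrix_inv (?P x) = matrix_inv (?P x')"
    have "invertible (?P x)" "invertible (?P x')" using x x' by (simp_all add: invertible_det_nz)
    then have "?P x = ?P x'"
      using arg_cong[OF eq, of matrix_inv] by (simp only: matrix_inv_inv(2))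
    moreover have "completion_map E x = completion_map E x'"
      using x x' F_eq[of x] F_eq[of x'] by simp
    ultimately show "x = x'" by (simp add: completion_map_def)
  next
    fix X assume "X \<in> (\<lambda>x. matrix_inv (?P x)) ` {x. det (?P x) \<noteq> 0 \<and> F x = T}"
    then obtain x where x: "det (?P x) \<noteq> 0" "F x = T" "X = matrix_inv (?P x)" by blast
    have "?P (matrix_inv (?P x)) = ?P S"
      using x(1,2) T completion_map_proj[of x] by (simp add: F_eq)
    then show "X \<in> ml_fibre E S"
      unfolding x(3) by (intro matrix_inv_in_ml_fibre S graph_proj_space) (simp add: invertible_det_nz x(1))
  next
    fix X assume "X \<in> ml_fibre E S"
    then show "X \<in> (\<lambda>x. matrix_inv (?P x)) ` {x. det (?P x) \<noteq> 0 \<and> F x = T}"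
      using surj by blast
  qed
qed

end

text \<open>The definite description in \<open>ml_degree\<close> needs a generic count that exists
  and is unique. Existence comes from the generic fibre of the completion map, uniqueness from a
  symmetric matrix that is generic in both senses.\<close>

theorem ml_degree_generic:
  fixes E :: "'n::finite set set"
  shows "for_generic_sym (\<lambda>S. finite (ml_fibre E S) \<and> card (ml_fibre E S) = ml_degree E)"
proof -
  interpret completion E .
  let ?P = "graph_proj E"
  obtain f' where f': "(F has_derivative f') (at (mat 1))" "inj f'" by (rule derivative_at_1)
  obtain p d y0 where p: "entry_polynomial p" "p y0 \<noteq> 0"
    and gen: "\<And>y. p y \<noteq> 0 \<Longrightarrow> finite {x. det (?P x) \<noteq> 0 \<and> F x = y} \<and>
      card {x. det (?P x) \<noteq> 0 \<and> F x = y} = d \<and>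
      (\<exists>C. \<forall>\<^sub>F y' in nhds y. \<forall>x. det (?P x) \<noteq> 0 \<and> F x = y' \<longrightarrow> norm x \<le> C)"
    using generic_fibre[OF det_proj_1 f'] by blast
  \<comment> \<open>The polynomial p may vanish on all symmetric matrices. Its argument is therefore
    shifted by A, the antisymmetric part of \<open>y0\<close>; the shifted polynomial is nonzero at
    the symmetric part, and the projection annihilates A.\<close>
  define A where "A = y0 - symmetrize y0"
  have "A $ i $ j + A $ j $ i = 0" for i j by (simp add: A_def symmetrize_def field_simps)
  then have PA: "?P A = 0" by (simp add: graph_proj_def vec_eq_iff)
  let ?Q = "\<lambda>d S. finite (ml_fibre E S) \<and> card (ml_fibre E S) = d"
  have ex: "for_generic_sym (?Q d)"
    unfolding for_generic_sym_def
  proof (intro exI[of _ "\<lambda>S. p (S + A)"] conjI ballI impI)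
    show "entry_polynomial (\<lambda>S. p (S + A))"
      by (rule entry_polynomial_compose[OF p(1)]) (auto intro!: entry_polynomial_intros)
    show "\<exists>S\<in>sym_mats. p (S + A) \<noteq> 0"
      using p(2) by (intro bexI[of _ "symmetrize y0"]) (auto simp: A_def)
    fix S assume S: "S \<in> sym_mats" "p (S + A) \<noteq> 0"
    have "?P (S + A) = ?P S" by (simp add: graph_proj_simps PA)
    then obtain g where g: "bij_betw g {x. det (?P x) \<noteq> 0 \<and> F x = S + A} (ml_fibre E S)"
      using gen[OF S(2)] bij_ml_fibre[OF S(1)] by blast
    show "finite (ml_fibre E S)" "card (ml_fibre E S) = d"
      using gen[OF S(2)] bij_betw_finite[OF g] bij_betw_same_card[OF g] by simp_all
  qed
  have uniq: "d' = d" if "for_generic_sym (?Q d')" for d'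
  proof -
    from that obtain p1 S1 where p1: "entry_polynomial p1" "S1 \<in> sym_mats" "p1 S1 \<noteq> 0"
      "\<And>S. S \<in> sym_mats \<Longrightarrow> p1 S \<noteq> 0 \<Longrightarrow> ?Q d' S"
      unfolding for_generic_sym_def by blast
    from ex obtain p2 S2 where p2: "entry_polynomial p2" "S2 \<in> sym_mats" "p2 S2 \<noteq> 0"
      "\<And>S. S \<in> sym_mats \<Longrightarrow> p2 S \<noteq> 0 \<Longrightarrow> ?Q d S"
      unfolding for_generic_sym_def by blast
    have "\<exists>x. p1 (symmetrize x) * p2 (symmetrize x) \<noteq> 0"
      by (rule entry_polynomial_mult_nonzero[where a = S1 and b = S2])
        (use p1 p2 in \<open>auto intro!: entry_polynomial_compose entry_polynomial_symmetrize simp: symmetrize_id\<close>)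
    then obtain x where "p1 (symmetrize x) \<noteq> 0" "p2 (symmetrize x) \<noteq> 0" by auto
    with p1(4)[of "symmetrize x"] p2(4)[of "symmetrize x"] show ?thesis by simp
  qed
  have "ml_degree E = d"
    unfolding ml_degree_def using ex uniq by (rule the_equality)
  with ex show ?thesis by simp
qed

section \<open>Lower bounds from the neighbourhood of one matrix\<close>

text \<open>Every neighbourhood of S0 contains a generic symmetric matrix, whose fibre is finite of
  size \<open>ml_degree E\<close>; S0 itself may be exceptional.\<close>

lemma ml_degree_ge:
  fixes E :: "'n::finite set set"
  assumes "S0 \<in> sym_mats"
    and "\<forall>\<^sub>F S in nhds S0. S \<in> sym_mats \<longrightarrow> (\<exists>X\<subseteq>ml_fibre E S. card X = N)"
  shows "ml_degree E \<ge> N"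
proof -
  obtain p S1 where p: "entry_polynomial p" "S1 \<in> sym_mats" "p S1 \<noteq> 0"
    "\<And>S. S \<in> sym_mats \<Longrightarrow> p S \<noteq> 0 \<Longrightarrow> finite (ml_fibre E S) \<and> card (ml_fibre E S) = ml_degree E"
    using ml_degree_generic[of E] unfolding for_generic_sym_def by blast
  obtain U where U: "open U" "S0 \<in> U" "\<And>S. S \<in> U \<Longrightarrow> S \<in> sym_mats \<Longrightarrow> \<exists>X\<subseteq>ml_fibre E S. card X = N"
    using assms(2) unfolding eventually_nhds by blast
  have "continuous_on UNIV (symmetrize :: complex ^ 'n ^ 'n \<Rightarrow> _)"
    unfolding symmetrize_def by (intro continuous_on_vec_lambda continuous_intros) auto
  then have "open (symmetrize -` U)" using U(1) by (rule open_vimage[rotated])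
  moreover have "S0 \<in> symmetrize -` U" using U(2) by (simp add: symmetrize_id assms(1))
  moreover have "entry_polynomial (\<lambda>x. p (symmetrize x))"
    by (rule entry_polynomial_compose[OF p(1) entry_polynomial_symmetrize])
  ultimately obtain x where x: "symmetrize x \<in> U" "p (symmetrize x) \<noteq> 0"
    using entry_polynomial_nonzero_on_open[of "\<lambda>x. p (symmetrize x)" S1] p(2,3)
    by (auto simp: symmetrize_id)
  obtain X where "X \<subseteq> ml_fibre E (symmetrize x)" "card X = N"
    using U(3)[OF x(1)] by auto
  then show ?thesis using p(4)[OF _ x(2)] card_mono by fastforce
qed

lemma ml_degree_ge_limits:
  fixes E :: "'n::finite set set"
  assumes S0: "S0 \<in> sym_mats" and Q: "finite Q"
    and lim: "\<And>Y e. Y \<in> Q \<Longrightarrow> e > 0 \<Longrightarrow>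
      \<forall>\<^sub>F S in nhds S0. S \<in> sym_mats \<longrightarrow> (\<exists>X\<in>ml_fibre E S. dist X Y < e)"
  shows "ml_degree E \<ge> card Q"
proof -
  \<comment> \<open>At most half the least distance between distinct points of Q, so that the
    e-balls around them are disjoint. The inserted 1 keeps the minimum defined when Q has fewer than
    two points.\<close>
  define e where "e = Min (insert 1 {dist Y Y' | Y Y'. Y \<in> Q \<and> Y' \<in> Q \<and> Y \<noteq> Y'}) / 2"
  have fin: "finite {dist Y Y' | Y Y'. Y \<in> Q \<and> Y' \<in> Q \<and> Y \<noteq> Y'}"
    by (rule finite_subset[of _ "case_prod dist ` (Q \<times> Q)"]) (use Q in auto)
  have e: "e > 0" unfolding e_def using fin by (auto simp: Min_gr_iff)
  have sep: "2 * e \<le> dist Y Y'" if "Y \<in> Q" "Y' \<in> Q" "Y \<noteq> Y'" for Y Y'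
    unfolding e_def using fin that by (auto intro!: Min_le)
  have "\<forall>\<^sub>F S in nhds S0. \<forall>Y\<in>Q. S \<in> sym_mats \<longrightarrow> (\<exists>X\<in>ml_fibre E S. dist X Y < e)"
    using Q by (intro eventually_ball_finite ballI lim e)
  then have "\<forall>\<^sub>F S in nhds S0. S \<in> sym_mats \<longrightarrow> (\<exists>X\<subseteq>ml_fibre E S. card X = card Q)"
  proof eventually_elim
    case (elim S)
    show ?case
    proof
      assume "S \<in> sym_mats"
      then have "\<forall>Y\<in>Q. \<exists>X. X \<in> ml_fibre E S \<and> dist X Y < e" using elim by blast
      then obtain g where g: "\<And>Y. Y \<in> Q \<Longrightarrow> g Y \<in> ml_fibre E S \<and> dist (g Y) Y < e"
        using bchoice[of Q "\<lambda>Y X. X \<in> ml_fibre E S \<and> dist X Y < e"] by blast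
      have "inj_on g Q"
      proof (rule inj_onI, rule ccontr)
        fix Y Y' assume Y: "Y \<in> Q" "Y' \<in> Q" "g Y = g Y'" "Y \<noteq> Y'"
        have "dist Y Y' \<le> dist (g Y) Y + dist (g Y) Y'" by (metis dist_commute dist_triangle)
        also have "\<dots> < 2 * e" using g[OF Y(1)] g[OF Y(2)] Y(3) by simp
        finally show False using sep[OF Y(1,2,4)] by simp
      qed
      then show "\<exists>X\<subseteq>ml_fibre E S. card X = card Q"
        using g by (intro exI[of _ "g ` Q"]) (auto simp: card_image)
    qed
  qed
  with S0 show ?thesis by (rule ml_degree_ge)
qed

text \<open>The completion map fixes the identity matrix and is open there by injectivity of its
  derivative, so S near it has a preimage near it.\<close>

lemma ml_fibre_near_1:
  fixes E :: "'n::finite set set"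
  assumes e: "e > 0"
  shows "\<forall>\<^sub>F S in nhds (mat 1). S \<in> sym_mats \<longrightarrow> (\<exists>X\<in>ml_fibre E S. dist X (mat 1) < e)"
proof -
  interpret completion E .
  let ?P = "graph_proj E"
  obtain f' where f': "(F has_derivative f') (at (mat 1))" "inj f'" by (rule derivative_at_1)
  have P1: "?P (mat 1) = mat 1" by (rule graph_proj_id[OF mat_1_graph_space])
  have inv1: "matrix_inv (mat 1) = (mat 1 :: complex ^ 'n ^ 'n)"
    by (rule matrix_inv_unique) simp
  have F1: "F (mat 1) = mat 1" using det_proj_1 by (simp add: F_eq completion_map_def P1 inv1)
  define T where "T = {x. det (?P x) \<noteq> 0} \<inter> {x. dist (matrix_inv (?P x)) (mat 1) < e}"
  have "((\<lambda>x. matrix_inv (?P x)) \<longlongrightarrow> matrix_inv (?P (mat 1))) (nhds (mat 1))"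
    by (intro tendsto_matrix_inv tendsto_graph_proj filterlim_ident det_proj_1)
  then have "\<forall>\<^sub>F x in nhds (mat 1). dist (matrix_inv (?P x)) (mat 1) < e"
    using e by (simp add: P1 inv1 tendsto_iff)
  moreover have "\<forall>\<^sub>F x in nhds (mat 1). det (?P x) \<noteq> 0"
    using eventually_nhds_in_open[OF open_domain, of "mat 1"] det_proj_1 by simp
  ultimately have "\<forall>\<^sub>F x in nhds (mat 1). x \<in> T"
    unfolding T_def by eventually_elim simp
  then have "mat 1 \<in> interior T"
    unfolding eventually_nhds interior_def by blast
  then have "F (mat 1) \<in> interior (F ` T)"
    by (intro open_at_injective_derivative[OF open_domain continuous_on_F _ f'])
      (auto simp: T_def det_proj_1)
  then have "\<forall>\<^sub>F S in nhds (mat 1). S \<in> interior (F ` T)"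
    unfolding F1 by (intro eventually_nhds_in_open open_interior)
  then show ?thesis
  proof eventually_elim
    case (elim S)
    show ?case
    proof
      assume S: "S \<in> sym_mats"
      obtain x where x: "x \<in> T" "F x = S" using elim interior_subset by blast
      have "?P (matrix_inv (?P x)) = ?P S"
        using x completion_map_proj[of x] by (auto simp: F_eq T_def)
      then have "matrix_inv (?P x) \<in> ml_fibre E S"
        using x(1) by (intro matrix_inv_in_ml_fibre S graph_proj_space)
          (auto simp: T_def invertible_det_nz)
      then show "\<exists>X\<in>ml_fibre E S. dist X (mat 1) < e" using x(1) by (auto simp: T_def)
    qed
  qed
qed

section \<open>The cycle\<close>

locale labelled_cycle =
  fixes n :: nat and v :: "nat \<Rightarrow> 'n::finite" and E :: "'n set set"
  assumes v: "bij_betw v {..<n} UNIV" and n_ge_3: "n \<ge> 3"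
    and E: "E = {{v i, v (Suc i mod n)} | i. i < n}"
begin

definition w :: "'n \<Rightarrow> nat" where "w = inv_into {..<n} v"

lemma w_less [simp]: "w p < n"
  using inv_into_into[of p v "{..<n}"] v by (simp add: w_def bij_betw_def)

lemma v_w [simp]: "v (w p) = p"
  using f_inv_into_f[of p v "{..<n}"] v by (simp add: w_def bij_betw_def)

lemma w_v [simp]: "i < n \<Longrightarrow> w (v i) = i"
  using v by (simp add: w_def bij_betw_def)

lemma w_eq_iff: "i < n \<Longrightarrow> w p = i \<longleftrightarrow> p = v i"
  by auto

definition nx :: "nat \<Rightarrow> nat" where "nx i = Suc i mod n"

definition pv :: "nat \<Rightarrow> nat" where "pv i = (if i = 0 then n - 1 else i - 1)"

lemma nx_less [simp]: "nx i < n" using n_ge_3 by (simp add: nx_def)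

lemma pv_less [simp]: "i < n \<Longrightarrow> pv i < n" by (auto simp: pv_def)

lemma nx_Suc: "Suc i < n \<Longrightarrow> nx i = Suc i" by (simp add: nx_def)

lemma nx_last: "Suc i = n \<Longrightarrow> nx i = 0" by (simp add: nx_def)

lemma nx_eq_iff:
  assumes "i < n" "k < n"
  shows "nx k = i \<longleftrightarrow> k = pv i"
  using assms by (cases "Suc k = n") (auto simp: nx_Suc nx_last pv_def split: if_splits)

text \<open>The Floquet solution with initial value 1 and quotients t; after one turn it has been
  multiplied by \<open>rho t\<close>.\<close>

definition z :: "complex ^ 'n \<Rightarrow> nat \<Rightarrow> complex" where
  "z t i = (\<Prod>k<i. t $ v k)"

definition rho :: "complex ^ 'n \<Rightarrow> complex" where
  "rho t = (\<Prod>p\<in>UNIV. t $ p)"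

lemma z_0 [simp]: "z t 0 = 1" and z_Suc: "z t (Suc i) = z t i * t $ v i"
  by (simp_all add: z_def)

lemma z_n: "z t n = rho t"
  using prod.reindex_bij_betw[OF v, of "\<lambda>p. t $ p"] by (simp add: z_def rho_def)

lemma z_nonzero: "(\<And>p. t $ p \<noteq> 0) \<Longrightarrow> z t i \<noteq> 0"
  by (simp add: z_def)

lemma rho_nonzero: "(\<And>p. t $ p \<noteq> 0) \<Longrightarrow> rho t \<noteq> 0"
  by (simp add: rho_def)

text \<open>
  This is the covariance matrix of a periodic tridiagonal concentration matrix, normalised to have
  unit diagonal: \<open>t\<close> lists the quotients of consecutive values of a solution of the three-term
  recurrence with Floquet multiplier \<open>rho t\<close>, and the second solution has the reciprocal quotients.
\<close>

definition cov :: "complex ^ 'n \<Rightarrow> nat \<Rightarrow> nat \<Rightarrow> complex" where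
  "cov t i j = (let x = z t (min i j); y = z t (max i j) in (y / x + rho t * x / y) / (1 + rho t))"

lemma cov_le: "i \<le> j \<Longrightarrow> cov t i j = (z t j / z t i + rho t * z t i / z t j) / (1 + rho t)"
  by (simp add: cov_def Let_def)

lemma cov_ge: "j \<le> i \<Longrightarrow> cov t i j = (z t i / z t j + rho t * z t j / z t i) / (1 + rho t)"
  by (simp add: cov_def Let_def)

lemma cov_sym: "cov t i j = cov t j i"
  by (simp add: cov_def min.commute max.commute)

context
  fixes t :: "complex ^ 'n"
  assumes t0: "\<And>p. t $ p \<noteq> 0"
begin

text \<open>For the last position the successor is 0, which reverses the order of the arguments of
  \<open>cov\<close>. There z t i * t $ v i = rho t, so the two summands merely change places and
  the formula persists. This is how the recurrence closes up around the cycle.\<close>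

lemma cov_nx_ge:
  assumes "j \<le> i" "i < n"
  shows "cov t (nx i) j = (z t i * t $ v i / z t j + rho t * z t j / (z t i * t $ v i)) / (1 + rho t)"
proof (cases "Suc i = n")
  case True
  then have "z t i * t $ v i = rho t" by (metis z_Suc z_n)
  with True show ?thesis
    using z_nonzero[OF t0] rho_nonzero[OF t0] by (simp add: nx_last cov_le add.commute)
next
  case False
  with assms show ?thesis by (simp add: nx_Suc cov_ge z_Suc)
qed

lemma cov_nx_less:
  assumes "i < j" "j < n"
  shows "cov t (nx i) j = (z t j / (z t i * t $ v i) + rho t * (z t i * t $ v i) / z t j) / (1 + rho t)"
  using assms by (simp add: nx_Suc cov_le z_Suc)

lemma z_pv:
  assumes "0 < i"
  shows "z t i = z t (pv i) * t $ v (pv i)"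
  using assms z_Suc[of t "i - 1"] by (simp add: pv_def)

lemma cov_pv_le:
  assumes "i \<le> j" "j < n"
  shows "cov t (pv i) j =
    (z t j * t $ v (pv i) / z t i + rho t * z t i / (z t j * t $ v (pv i))) / (1 + rho t)"
proof (cases "i = 0")
  case True
  have "rho t = z t (n - 1) * t $ v (n - 1)"
    using z_Suc[of t "n - 1"] assms by (simp add: z_n)
  with True assms show ?thesis
    using z_nonzero[OF t0] t0 by (simp add: cov_ge pv_def add.commute)
next
  case False
  then have "pv i \<le> j" using assms by (simp add: pv_def)
  then show ?thesis
    using False z_nonzero[OF t0] t0 by (simp add: cov_le z_pv mult.assoc)
qed

lemma cov_pv_greater:
  assumes "j < i" "i < n"
  shows "cov t (pv i) j =
    (z t i / (t $ v (pv i) * z t j) + rho t * z t j * t $ v (pv i) / z t i) / (1 + rho t)"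
proof -
  have "j \<le> pv i" "0 < i" using assms by (auto simp: pv_def)
  then show ?thesis
    using z_nonzero[OF t0] t0 by (simp add: cov_ge z_pv mult.assoc)
qed

end

section \<open>The concentration matrix\<close>

text \<open>The entry between positions i and \<open>nx i\<close> for unit scalings. The product of
  \<open>b t i\<close> with t $ v i - 1 / t $ v i is the Wronskian of the two solutions, hence the
  same for all i; its value is fixed by the diagonal of the product with \<open>cov\<close> being
  1.\<close>

definition b :: "complex ^ 'n \<Rightarrow> nat \<Rightarrow> complex" where
  "b t i = (1 + rho t) / (1 - rho t) / (t $ v i - 1 / t $ v i)"

definition a :: "complex ^ 'n \<Rightarrow> nat \<Rightarrow> complex" where
  "a t i = - b t (pv i) / t $ v (pv i) - b t i * t $ v i"

text \<open>The equations \<open>A1\<close> and \<open>A2\<close> say that row i annihilates the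
  solutions with quotients t and 1 / t. Away from the diagonal \<open>cov\<close> is a combination
  of these two across all three neighbours; on the diagonal the formula changes sides.\<close>

lemma conc_cov:
  assumes t: "\<And>p. t $ p \<noteq> 0" "\<And>p. (t $ p)\<^sup>2 \<noteq> 1" and r: "rho t \<noteq> 1" "rho t \<noteq> -1"
    and ij: "i < n" "j < n"
  shows "a t i * cov t i j + b t i * cov t (nx i) j + b t (pv i) * cov t (pv i) j = (if i = j then 1 else 0)"
proof -
  define u s where "u = t $ v i" and "s = t $ v (pv i)"
  define x c where "x = z t i" and "c = z t j"
  define bi bp A R where "bi = b t i" and "bp = b t (pv i)" and "A = a t i" and "R = rho t"
  have nz: "u \<noteq> 0" "s \<noteq> 0" "x \<noteq> 0" "c \<noteq> 0" using t(1) z_nonzero by (auto simp: u_def s_def x_def c_def)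
  have R: "1 + R \<noteq> 0" "1 - R \<noteq> 0" using r by (auto simp: R_def add_eq_0_iff)
  have "u - 1 / u \<noteq> 0" "s - 1 / s \<noteq> 0"
    using nz t(2)[of "v i"] t(2)[of "v (pv i)"] by (auto simp: u_def s_def field_simps power2_eq_square)
  then have W: "bi * (u - 1 / u) = (1 + R) / (1 - R)" "bp * (s - 1 / s) = (1 + R) / (1 - R)"
    by (auto simp: bi_def bp_def b_def u_def s_def R_def)
  have A1: "A + bi * u + bp / s = 0" by (simp add: A_def a_def bi_def bp_def u_def s_def)
  have "A + bi / u + bp * s = (A + bi * u + bp / s) - bi * (u - 1 / u) + bp * (s - 1 / s)"
    by (simp add: algebra_simps)
  then have A2: "A + bi / u + bp * s = 0" by (simp add: A1 W)
  have combine: "A * (X / (1 + R)) + bi * (Y / (1 + R)) + bp * (Z / (1 + R)) =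
      (A * X + bi * Y + bp * Z) / (1 + R)" for X Y Z
    by (simp add: add_divide_distrib)
  note folds = u_def[symmetric] s_def[symmetric] x_def[symmetric] c_def[symmetric] R_def[symmetric]
  consider "i < j" | "i = j" | "j < i" by linarith
  then have "A * cov t i j + bi * cov t (nx i) j + bp * cov t (pv i) j = (if i = j then 1 else 0)"
  proof cases
    case 1
    have "A * cov t i j + bi * cov t (nx i) j + bp * cov t (pv i) j =
        (A * (c / x + R * x / c) + bi * (c / (x * u) + R * (x * u) / c) +
          bp * (c * s / x + R * x / (c * s))) / (1 + R)"
      using cov_le[of i j t] cov_nx_less[OF t(1), of i j] cov_pv_le[OF t(1), of i j] 1 ij
      unfolding folds by (simp only: combine less_imp_le)
    also have "\<dots> = (c / x * (A + bi / u + bp * s) + R * x / c * (A + bi * u + bp / s)) / (1 + R)"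
      by (rule arg_cong[where f = "\<lambda>X. X / (1 + R)"]) (use nz in \<open>simp add: field_simps\<close>)
    finally show ?thesis using 1 by (simp add: A1 A2)
  next
    case 2
    then have cx: "c = x" by (simp add: c_def x_def)
    have "A * cov t i j + bi * cov t (nx i) j + bp * cov t (pv i) j =
        (A * (1 + R) + bi * (u + R / u) + bp * (s + R / s)) / (1 + R)"
    proof -
      have "cov t i j = (1 + R) / (1 + R)"
        using cov_le[of i j t] 2 nz unfolding folds by (simp add: cx)
      moreover have "cov t (nx i) j = (u + R / u) / (1 + R)"
        using cov_nx_ge[OF t(1), of j i] 2 ij nz unfolding folds by (simp add: cx)
      moreover have "cov t (pv i) j = (s + R / s) / (1 + R)"
        using cov_pv_le[OF t(1), of i j] 2 ij nz unfolding folds by (simp add: cx)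
      ultimately show ?thesis by (simp only: combine)
    qed
    \<comment> \<open>What survives on the diagonal is the Wronskian times 1 - R, that is, 1 +
      R.\<close>
    also have "\<dots> = ((A + bi * u + bp / s) + R * (A + bi / u + bp * s) + bp * (s - 1 / s) * (1 - R)) / (1 + R)"
      by (rule arg_cong[where f = "\<lambda>X. X / (1 + R)"]) (use nz in \<open>simp add: field_simps\<close>)
    also have "\<dots> = 1" using R by (simp add: A1 A2 W)
    finally show ?thesis using 2 by simp
  next
    case 3
    have "A * cov t i j + bi * cov t (nx i) j + bp * cov t (pv i) j =
        (A * (x / c + R * c / x) + bi * (x * u / c + R * c / (x * u)) +
          bp * (x / (s * c) + R * c * s / x)) / (1 + R)"
      using cov_ge[of j i t] cov_nx_ge[OF t(1), of j i] cov_pv_greater[OF t(1), of j i] 3 ij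
      unfolding folds by (simp only: combine less_imp_le)
    also have "\<dots> = (x / c * (A + bi * u + bp / s) + R * c / x * (A + bi / u + bp * s)) / (1 + R)"
      by (rule arg_cong[where f = "\<lambda>X. X / (1 + R)"]) (use nz in \<open>simp add: field_simps\<close>)
    finally show ?thesis using 3 by (simp add: A1 A2)
  qed
  then show ?thesis by (simp add: A_def bi_def bp_def)
qed

text \<open>A sum of indicator terms instead of a case distinction, so that a row of the product
  with \<open>cov_mat\<close> splits into the three terms of \<open>conc_cov\<close>.\<close>

definition conc_mat :: "complex ^ 'n \<Rightarrow> complex ^ 'n \<Rightarrow> complex ^ 'n ^ 'n" where
  "conc_mat d t = (\<chi> p q. ((if p = q then a t (w p) else 0) +
    (if nx (w p) = w q then b t (w p) else 0) +
    (if nx (w q) = w p then b t (w q) else 0)) / (d $ p * d $ q))"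

definition cov_mat :: "complex ^ 'n \<Rightarrow> complex ^ 'n \<Rightarrow> complex ^ 'n ^ 'n" where
  "cov_mat d t = (\<chi> p q. d $ p * d $ q * cov t (w p) (w q))"

lemma edge_nx: "{p, v (nx (w p))} \<in> E"
  unfolding E nx_def by (auto intro!: exI[of _ "w p"])

lemma edge_cases:
  assumes "{p, q} \<in> E"
  shows "q = v (nx (w p)) \<or> p = v (nx (w q))"
  using assms unfolding E nx_def by (auto simp: doubleton_eq_iff)

lemma conc_mat_graph_space: "conc_mat d t \<in> graph_space E"
proof -
  have "conc_mat d t \<in> sym_mats" by (auto simp: mem_sym_mats conc_mat_def ac_simps)
  moreover have "conc_mat d t $ p $ q = 0" if "p \<noteq> q" "{p, q} \<notin> E" for p q
  proof -
    have "nx (w p) \<noteq> w q" using edge_nx[of p] that by (metis v_w)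
    moreover have "nx (w q) \<noteq> w p" using edge_nx[of q] that by (metis v_w insert_commute)
    ultimately show ?thesis using that by (simp add: conc_mat_def)
  qed
  ultimately show ?thesis by (simp add: graph_space_def)
qed

lemma conc_cov_mat:
  assumes t: "\<And>p. t $ p \<noteq> 0" "\<And>p. (t $ p)\<^sup>2 \<noteq> 1" and r: "rho t \<noteq> 1" "rho t \<noteq> -1"
    and d: "\<And>p. d $ p \<noteq> 0"
  shows "conc_mat d t ** cov_mat d t = mat 1"
proof -
  have "(conc_mat d t ** cov_mat d t) $ p $ q = (mat 1 :: complex ^ 'n ^ 'n) $ p $ q" for p q
  proof -
    let ?k = "\<lambda>r. (if p = r then a t (w p) else 0) + (if nx (w p) = w r then b t (w p) else 0) +
        (if nx (w r) = w p then b t (w r) else 0)"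
    have "(conc_mat d t ** cov_mat d t) $ p $ q = (\<Sum>r\<in>UNIV. (d $ q / d $ p) * (?k r * cov t (w r) (w q)))"
      unfolding matrix_matrix_mult_def vec_lambda_beta
      by (intro sum.cong refl) (use d in \<open>simp add: conc_mat_def cov_mat_def\<close>)
    also have "\<dots> = (d $ q / d $ p) * (\<Sum>r\<in>UNIV. ?k r * cov t (w r) (w q))"
      by (simp only: sum_distrib_left)
    also have "(\<Sum>r\<in>UNIV. ?k r * cov t (w r) (w q)) =
        (\<Sum>r\<in>UNIV. (if r = p then a t (w p) * cov t (w p) (w q) else 0) +
        (if r = v (nx (w p)) then b t (w p) * cov t (nx (w p)) (w q) else 0) +
        (if r = v (pv (w p)) then b t (pv (w p)) * cov t (pv (w p)) (w q) else 0))"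
    proof (intro sum.cong refl)
      fix r
      have n1: "nx (w p) = w r \<longleftrightarrow> r = v (nx (w p))" using w_eq_iff[of "nx (w p)" r] by auto
      have n2: "nx (w r) = w p \<longleftrightarrow> r = v (pv (w p))"
        using nx_eq_iff[of "w p" "w r"] w_eq_iff[of "pv (w p)" r] by simp
      show "?k r * cov t (w r) (w q) = (if r = p then a t (w p) * cov t (w p) (w q) else 0) +
        (if r = v (nx (w p)) then b t (w p) * cov t (nx (w p)) (w q) else 0) +
        (if r = v (pv (w p)) then b t (pv (w p)) * cov t (pv (w p)) (w q) else 0)"
        unfolding n1 n2 distrib_right by (intro arg_cong2[where f = "(+)"]) simp_all
    qed
    also have "\<dots> = a t (w p) * cov t (w p) (w q) + b t (w p) * cov t (nx (w p)) (w q) +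
        b t (pv (w p)) * cov t (pv (w p)) (w q)"
      by (simp add: sum.distrib)
    also have "\<dots> = (if w p = w q then 1 else 0)"
      using conc_cov[OF t r] by simp
    also have "(d $ q / d $ p) * \<dots> = mat 1 $ p $ q"
      using d[of p] by (auto simp: mat_def w_eq_iff)
    finally show ?thesis .
  qed
  then show ?thesis by (simp add: vec_eq_iff)
qed

lemma cov_mat_in_inv_generic:
  assumes "\<And>p. t $ p \<noteq> 0" "\<And>p. (t $ p)\<^sup>2 \<noteq> 1" "rho t \<noteq> 1" "rho t \<noteq> -1" "\<And>p. d $ p \<noteq> 0"
  shows "cov_mat d t \<in> graph_space_inv E"
proof -
  have "invertible (conc_mat d t)" "matrix_inv (conc_mat d t) = cov_mat d t"
    using matrix_inv_unique[OF conc_cov_mat[OF assms]] by blast+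
  then have "cov_mat d t \<in> matrix_inv ` {M \<in> graph_space E. invertible M}"
    using conc_mat_graph_space by (intro image_eqI[of _ _ "conc_mat d t"]) auto
  then show ?thesis unfolding graph_space_inv_def by (rule subsetD[OF closure_subset])
qed


lemma tendsto_z: "(f \<longlongrightarrow> t) net \<Longrightarrow> ((\<lambda>x. z (f x) i) \<longlongrightarrow> z t i) net"
  unfolding z_def by (intro tendsto_prod tendsto_vec_nth)

lemma tendsto_rho: "(f \<longlongrightarrow> t) net \<Longrightarrow> ((\<lambda>x. rho (f x)) \<longlongrightarrow> rho t) net"
  unfolding rho_def by (intro tendsto_prod tendsto_vec_nth)

lemma tendsto_cov_mat:
  assumes "(g \<longlongrightarrow> d) net" "(f \<longlongrightarrow> t) net" "\<And>p. t $ p \<noteq> 0" "rho t \<noteq> -1"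
  shows "((\<lambda>x. cov_mat (g x) (f x)) \<longlongrightarrow> cov_mat d t) net"
proof -
  have "1 + rho t \<noteq> 0" using assms(4) by (simp add: add_eq_0_iff)
  then have "((\<lambda>x. cov (f x) i j) \<longlongrightarrow> cov t i j) net" for i j
    unfolding cov_def Let_def
    by (intro tendsto_intros assms(2) tendsto_z tendsto_rho z_nonzero assms(3))
  then have "((\<lambda>x. g x $ p * g x $ q * cov (f x) (w p) (w q)) \<longlongrightarrow> d $ p * d $ q * cov t (w p) (w q)) net"
    for p q
    by (intro tendsto_mult tendsto_vec_nth assms(1))
  then show ?thesis
    unfolding cov_mat_def by (intro vec_tendstoI) simp
qed

text \<open>At \<open>rho t = 1\<close> the entries \<open>b\<close> have a pole, but
  \<open>cov_mat\<close> is continuous there. Multiplying one coordinate of t by 1 + s moves the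
  multiplier to 1 + s and exhibits the matrix as a limit of points of the closed set.\<close>

lemma cov_mat_in_inv:
  assumes t: "\<And>p. t $ p \<noteq> 0" "\<And>p. (t $ p)\<^sup>2 \<noteq> 1" and r: "rho t \<noteq> -1" and d: "\<And>p. d $ p \<noteq> 0"
  shows "cov_mat d t \<in> graph_space_inv E"
proof (cases "rho t = 1")
  case False
  then show ?thesis using cov_mat_in_inv_generic assms by blast
next
  case True
  define p0 where "p0 = v 0"
  define f where "f s = (\<chi> p. if p = p0 then t $ p * (1 + complex_of_real s) else t $ p)" for s :: real
  have f: "(f \<longlongrightarrow> t) (at_right 0)"
  proof (rule vec_tendstoI)
    fix p
    have "((\<lambda>s. t $ p * (1 + complex_of_real s)) \<longlongrightarrow> t $ p * (1 + complex_of_real 0)) (at_right 0)"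
      by (intro tendsto_intros)
    then show "((\<lambda>s. f s $ p) \<longlongrightarrow> t $ p) (at_right 0)"
      by (cases "p = p0") (simp_all add: f_def)
  qed
  have rho_f: "rho (f s) = 1 + complex_of_real s" for s
  proof -
    have "rho (f s) = f s $ p0 * (\<Prod>p\<in>UNIV - {p0}. f s $ p)"
      unfolding rho_def by (rule prod.remove) auto
    also have "(\<Prod>p\<in>UNIV - {p0}. f s $ p) = (\<Prod>p\<in>UNIV - {p0}. t $ p)"
      by (rule prod.cong) (auto simp: f_def)
    also have "f s $ p0 * \<dots> = (1 + complex_of_real s) * (t $ p0 * (\<Prod>p\<in>UNIV - {p0}. t $ p))"
      by (simp add: f_def)
    also have "t $ p0 * (\<Prod>p\<in>UNIV - {p0}. t $ p) = rho t"
      unfolding rho_def by (rule prod.remove[symmetric]) auto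
    finally show ?thesis by (simp add: True)
  qed
  have lim: "((\<lambda>s. cov_mat d (f s)) \<longlongrightarrow> cov_mat d t) (at_right 0)"
    by (intro tendsto_cov_mat tendsto_const f t r)
  have "\<forall>\<^sub>F s in at_right 0. (f s $ p0)\<^sup>2 \<noteq> 1"
    by (rule tendsto_imp_eventually_ne[OF tendsto_power[OF tendsto_vec_nth[OF f]] t(2)])
  moreover have "\<forall>\<^sub>F s in at_right 0. (s::real) > 0" by (simp add: eventually_at_right_less)
  ultimately have "\<forall>\<^sub>F s in at_right 0. cov_mat d (f s) \<in> graph_space_inv E"
  proof eventually_elim
    case (elim s)
    have ne: "1 + complex_of_real s \<noteq> 0" "1 + complex_of_real s \<noteq> 1" "1 + complex_of_real s \<noteq> -1"
      using elim(2) by (auto simp: complex_eq_iff)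
    have "f s $ p \<noteq> 0" "(f s $ p)\<^sup>2 \<noteq> 1" for p
      using t ne(1) elim(1) by (auto simp: f_def)
    then show ?case
      using ne d by (intro cov_mat_in_inv_generic) (auto simp: rho_f)
  qed
  then show ?thesis
    using Lim_in_closed_set[of "graph_space_inv E", OF _ _ _ lim] by (simp add: graph_space_inv_def)
qed

section \<open>Nondegeneracy in the coordinates d and t\<close>

definition nxt :: "'n \<Rightarrow> 'n" where "nxt p = v (nx (w p))"

text \<open>One coordinate for each vertex and one for each of the n edges, so this is the same
  space as that of the pairs (d, t), and \<open>cov_coords\<close> becomes a self-map.\<close>

definition edge_coords :: "complex ^ 'n ^ 'n \<Rightarrow> (complex ^ 'n) \<times> (complex ^ 'n)" where
  "edge_coords S = ((\<chi> p. S $ p $ p), (\<chi> p. S $ p $ nxt p))"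

definition cov_coords :: "(complex ^ 'n) \<times> (complex ^ 'n) \<Rightarrow> (complex ^ 'n) \<times> (complex ^ 'n)" where
  "cov_coords dt = ((\<chi> p. (fst dt $ p)\<^sup>2),
    (\<chi> p. fst dt $ p * fst dt $ nxt p * ((snd dt $ p + rho (snd dt) / snd dt $ p) / (1 + rho (snd dt)))))"

lemma cov_mat_in_fibre:
  assumes t: "\<And>p. t $ p \<noteq> 0" "\<And>p. (t $ p)\<^sup>2 \<noteq> 1" and r: "rho t \<noteq> -1" and d: "\<And>p. d $ p \<noteq> 0"
    and S: "S \<in> sym_mats" "edge_coords S = cov_coords (d, t)"
  shows "cov_mat d t \<in> ml_fibre E S"
proof -
  have r1: "1 + rho t \<noteq> 0" using r by (simp add: add_eq_0_iff)
  let ?X = "cov_mat d t"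
  have symX: "?X $ p $ q = ?X $ q $ p" for p q
    by (simp add: cov_mat_def cov_sym[of t "w p"])
  have symS: "S $ p $ q = S $ q $ p" for p q using S(1) by (simp add: mem_sym_mats)
  have diag: "?X $ p $ p = S $ p $ p" for p
    using arg_cong[OF S(2), of "\<lambda>x. fst x $ p"] r1 z_nonzero[of t "w p"] t(1)
    by (simp add: edge_coords_def cov_coords_def cov_mat_def cov_le power2_eq_square)
  have edge: "?X $ p $ nxt p = S $ p $ nxt p" for p
  proof -
    have "cov t (w p) (nx (w p)) = (t $ p + rho t / t $ p) / (1 + rho t)"
      using cov_nx_ge[OF t(1), of "w p" "w p"] z_nonzero[OF t(1), of "w p"]
      by (simp add: cov_sym[of t "w p"])
    then show ?thesis
      using arg_cong[OF S(2), of "\<lambda>x. snd x $ p"]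
      by (simp add: edge_coords_def cov_coords_def cov_mat_def nxt_def)
  qed
  have entries: "?X $ p $ q = S $ p $ q" if pq: "p = q \<or> {p, q} \<in> E" for p q
  proof -
    consider "p = q" | "q = nxt p" | "p = nxt q" using pq edge_cases[of p q] unfolding nxt_def by blast
    then show ?thesis
    proof cases
      case 3
      then show ?thesis using edge[of q] symX[of p q] symS[of p q] by simp
    qed (use diag edge in auto)
  qed
  have "graph_proj E ?X $ p $ q = graph_proj E S $ p $ q" for p q
    using entries[of p q] entries[of q p] by (auto simp: graph_proj_def insert_commute)
  then have "graph_proj E ?X = graph_proj E S" by (simp add: vec_eq_iff)
  then show ?thesis
    using cov_mat_in_inv[OF t r d] by (simp add: ml_fibre_eq[OF S(1)])
qed

lemma open_cov_domain:
  "open {dt :: (complex ^ 'n) \<times> (complex ^ 'n). (\<forall>p. snd dt $ p \<noteq> 0) \<and> rho (snd dt) \<noteq> -1}"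
proof -
  have *: "{dt. (\<forall>p. snd dt $ p \<noteq> 0) \<and> rho (snd dt) \<noteq> -1} =
      (\<Inter>p. {dt :: (complex ^ 'n) \<times> (complex ^ 'n). snd dt $ p \<noteq> 0}) \<inter> {dt. rho (snd dt) \<noteq> -1}"
    by auto
  show ?thesis
    unfolding * unfolding rho_def
    by (intro open_Int open_INT ballI open_Collect_neq continuous_intros) auto
qed

lemma continuous_on_cov_coords:
  "continuous_on {dt. (\<forall>p. snd dt $ p \<noteq> 0) \<and> rho (snd dt) \<noteq> -1} cov_coords"
  unfolding cov_coords_def rho_def
  by (intro continuous_on_Pair continuous_on_vec_lambda continuous_intros)
    (auto simp: add_eq_0_iff)

text \<open>At these points t $ p + rho t / t $ p vanishes, so the variation of the scalings and of
  the denominator 1 + rho t contributes nothing to the edge component.\<close>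

lemma cov_coords_has_derivative:
  assumes t: "\<And>p. t $ p \<noteq> 0" and r: "\<And>p. (t $ p)\<^sup>2 = - rho t" and r1: "rho t \<noteq> -1"
  shows "(cov_coords has_derivative (\<lambda>h. ((\<chi> p. 2 * fst h $ p),
    (\<chi> p. (2 * snd h $ p + (\<Sum>q\<in>UNIV. snd h $ q * (rho t / t $ q)) / t $ p) / (1 + rho t)))))
    (at ((\<chi> p. 1), t))"
proof -
  let ?x = "((\<chi> p. 1), t) :: (complex ^ 'n) \<times> (complex ^ 'n)"
  have r0: "1 + rho t \<noteq> 0" using r1 by (simp add: add_eq_0_iff)
  have dd: "((\<lambda>dt. fst dt $ p) has_derivative (\<lambda>h. fst h $ p)) (at ?x)" for p
    by (intro bounded_linear.has_derivative[OF bounded_linear_vec_nth] has_derivative_fst has_derivative_ident)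
  have dt: "((\<lambda>dt. snd dt $ p) has_derivative (\<lambda>h. snd h $ p)) (at ?x)" for p
    by (intro bounded_linear.has_derivative[OF bounded_linear_vec_nth] has_derivative_snd has_derivative_ident)
  have rho_remove: "(\<Prod>q\<in>UNIV - {p}. t $ q) = rho t / t $ p" for p
    using t[of p] prod.remove[of UNIV p "\<lambda>q. t $ q"] by (simp add: rho_def)
  have drho: "((\<lambda>dt. rho (snd dt)) has_derivative (\<lambda>h. \<Sum>q\<in>UNIV. snd h $ q * (rho t / t $ q))) (at ?x)"
    using has_derivative_prod[where I = UNIV and f = "\<lambda>q dt. snd dt $ q" and f' = "\<lambda>q h. snd h $ q", OF dt]
    by (simp add: rho_remove flip: rho_def)
  have p1: "((\<lambda>dt. (fst dt $ p)\<^sup>2) has_derivative (\<lambda>h. 2 * fst h $ p)) (at ?x)" for p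
    unfolding power2_eq_square
    by (rule has_derivative_eq_rhs[OF has_derivative_mult[OF dd dd]]) auto
  have p2: "((\<lambda>dt. fst dt $ p * fst dt $ nxt p * ((snd dt $ p + rho (snd dt) / snd dt $ p) / (1 + rho (snd dt))))
    has_derivative (\<lambda>h. (2 * snd h $ p + (\<Sum>q\<in>UNIV. snd h $ q * (rho t / t $ q)) / t $ p) / (1 + rho t)))
    (at ?x)" (is "(_ has_derivative ?D) _") for p
  proof -
    let ?R = "\<lambda>h. \<Sum>q\<in>UNIV. snd h $ q * (rho t / t $ q)"
    have rt: "rho t = - (t $ p * t $ p)" using r[of p] by (simp add: power2_eq_square)
    have z: "t $ p + rho t / t $ p = 0" using t[of p] by (simp add: rt)
    have "((\<lambda>dt. snd dt $ p + rho (snd dt) / snd dt $ p) has_derivative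
        (\<lambda>h. snd h $ p + (?R h * t $ p - rho t * snd h $ p) / (t $ p * t $ p))) (at ?x)"
      using has_derivative_add[OF dt has_derivative_divide'[OF drho dt[of p]]] t[of p] by simp
    then have g: "((\<lambda>dt. snd dt $ p + rho (snd dt) / snd dt $ p) has_derivative
        (\<lambda>h. 2 * snd h $ p + ?R h / t $ p)) (at ?x)"
    proof (rule has_derivative_eq_rhs)
      have "x + (y * t $ p - rho t * x) / (t $ p * t $ p) = 2 * x + y / t $ p" for x y
        using t[of p] unfolding rt by (simp add: field_simps)
      then show "(\<lambda>h. snd h $ p + (?R h * t $ p - rho t * snd h $ p) / (t $ p * t $ p)) =
          (\<lambda>h. 2 * snd h $ p + ?R h / t $ p)" by (intro ext)
    qed
    have "((\<lambda>dt. (snd dt $ p + rho (snd dt) / snd dt $ p) / (1 + rho (snd dt))) has_derivative ?D) (at ?x)"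
    proof (rule has_derivative_eq_rhs[OF has_derivative_divide'[OF g has_derivative_add[OF has_derivative_const drho]]])
      show "1 + rho (snd ?x) \<noteq> 0" using r0 by simp
    qed (use r0 z in auto)
    note has_derivative_mult[OF has_derivative_mult[OF dd[of p] dd[of "nxt p"]] this]
    then show ?thesis by (rule has_derivative_eq_rhs) (use z in auto)
  qed
  show ?thesis
    unfolding cov_coords_def
    by (intro has_derivative_Pair has_derivative_vecI) (use p1 p2 in simp_all)
qed

text \<open>Let R be the variation of \<open>rho t\<close> along a kernel vector. The edge equations
  make each of its n summands equal to R / 2, hence R = n * R / 2. Since n differs from 2, R
  vanishes, and with it the whole vector.\<close>

lemma cov_coords_derivative_inj:
  assumes t: "\<And>p. t $ p \<noteq> 0" and r: "\<And>p. (t $ p)\<^sup>2 = - rho t" and r1: "rho t \<noteq> -1"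
  shows "inj (\<lambda>h. ((\<chi> p. 2 * fst h $ p) :: complex ^ 'n,
    (\<chi> p. (2 * snd h $ p + (\<Sum>q\<in>UNIV. snd h $ q * (rho t / t $ q)) / t $ p) / (1 + rho t)) :: complex ^ 'n))"
    (is "inj ?f")
proof -
  have "linear ?f"
    using cov_coords_has_derivative[OF assms] has_derivative_linear by blast
  moreover have "h = 0" if "?f h = 0" for h
  proof -
    let ?R = "\<Sum>q\<in>UNIV. snd h $ q * (rho t / t $ q)"
    have r0: "1 + rho t \<noteq> 0" using r1 by (simp add: add_eq_0_iff)
    have "fst h = 0" using arg_cong[OF that, of fst] by (simp add: vec_eq_iff)
    have s: "2 * snd h $ p + ?R / t $ p = 0" for p
      using arg_cong[OF that, of "\<lambda>x. snd x $ p"] r0 by simp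
    have "snd h $ p * (rho t / t $ p) = ?R / 2" for p
    proof -
      have "rho t = - (t $ p * t $ p)" using r[of p] by (simp add: power2_eq_square)
      then have "snd h $ p * (rho t / t $ p) = - (snd h $ p * t $ p)" using t[of p] by simp
      also have "\<dots> = ?R / 2 - (2 * snd h $ p + ?R / t $ p) * t $ p / 2"
        using t[of p] by (simp add: field_simps)
      finally show ?thesis by (simp only: s) simp
    qed
    then have "?R = (\<Sum>q\<in>(UNIV :: 'n set). ?R / 2)" by (intro sum.cong refl)
    then have "?R = of_nat CARD('n) * (?R / 2)" by simp
    moreover have "CARD('n) = n" using bij_betw_same_card[OF v] by simp
    ultimately have "?R * (of_nat n - 2) = 0" by (simp add: field_simps)
    moreover have "(of_nat n :: complex) \<noteq> of_nat 2" using n_ge_3 by (simp only: of_nat_eq_iff)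
    ultimately have "?R = 0" by simp
    then have "snd h = 0" using s by (simp add: vec_eq_iff)
    with \<open>fst h = 0\<close> show ?thesis by (simp add: prod_eq_iff)
  qed
  ultimately show ?thesis using linear_injective_0 by blast
qed

text \<open>As t $ p + rho t / t $ p vanishes, \<open>cov_coords\<close> sends (1, t) to the edge
  coordinates of the identity. It is open there, so the coordinates of nearby S are attained by
  pairs close to (1, t).\<close>

lemma ml_fibre_near_cov_mat:
  assumes t: "\<And>p. t $ p \<noteq> 0" "\<And>p. (t $ p)\<^sup>2 \<noteq> 1" and r: "\<And>p. (t $ p)\<^sup>2 = - rho t" and e: "e > 0"
  shows "\<forall>\<^sub>F S in nhds (mat 1). S \<in> sym_mats \<longrightarrow>
    (\<exists>X\<in>ml_fibre E S. dist X (cov_mat (\<chi> p. 1) t) < e)"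
proof -
  let ?x = "((\<chi> p. 1), t) :: (complex ^ 'n) \<times> (complex ^ 'n)"
  have r1: "rho t \<noteq> -1" using t(2) r by fastforce
  define T where "T = {dt. (\<forall>p. snd dt $ p \<noteq> 0) \<and> rho (snd dt) \<noteq> -1} \<inter>
    {dt. (\<forall>p. fst dt $ p \<noteq> 0) \<and> (\<forall>p. (snd dt $ p)\<^sup>2 \<noteq> 1) \<and>
      dist (cov_mat (fst dt) (snd dt)) (cov_mat (\<chi> p. 1) t) < e}"
  have lims: "(fst \<longlongrightarrow> (\<chi> p. 1)) (nhds ?x)" "(snd \<longlongrightarrow> t) (nhds ?x)"
    using tendsto_fst[OF filterlim_ident, of ?x] tendsto_snd[OF filterlim_ident, of ?x] by simp_all
  have "\<forall>\<^sub>F dt in nhds ?x. fst dt $ p \<noteq> 0" for p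
    by (rule tendsto_imp_eventually_ne[OF tendsto_vec_nth[OF lims(1)]]) simp
  then have "\<forall>\<^sub>F dt in nhds ?x. \<forall>p. fst dt $ p \<noteq> 0" by (rule eventually_all_finite)
  moreover have "\<forall>\<^sub>F dt in nhds ?x. (snd dt $ p)\<^sup>2 \<noteq> 1" for p
    by (rule tendsto_imp_eventually_ne[OF tendsto_power[OF tendsto_vec_nth[OF lims(2)]] t(2)])
  then have "\<forall>\<^sub>F dt in nhds ?x. \<forall>p. (snd dt $ p)\<^sup>2 \<noteq> 1" by (rule eventually_all_finite)
  moreover have "\<forall>\<^sub>F dt in nhds ?x. dist (cov_mat (fst dt) (snd dt)) (cov_mat (\<chi> p. 1) t) < e"
    using tendstoD[OF tendsto_cov_mat[OF lims t(1) r1] e] .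
  moreover have "\<forall>\<^sub>F dt in nhds ?x. dt \<in> {dt. (\<forall>p. snd dt $ p \<noteq> 0) \<and> rho (snd dt) \<noteq> -1}"
    by (rule eventually_nhds_in_open[OF open_cov_domain]) (use t r1 in simp)
  ultimately have "\<forall>\<^sub>F dt in nhds ?x. dt \<in> T"
    unfolding T_def by eventually_elim simp
  then have "?x \<in> interior T" unfolding eventually_nhds interior_def by blast
  then have "cov_coords ?x \<in> interior (cov_coords ` T)"
    by (intro open_at_injective_derivative[OF open_cov_domain continuous_on_cov_coords _
          cov_coords_has_derivative[OF t(1) r r1] cov_coords_derivative_inj[OF t(1) r r1]])
      (use t r1 in \<open>auto simp: T_def\<close>)
  moreover have "cov_coords ?x = edge_coords (mat 1)"
  proof -
    have "t $ p + rho t / t $ p = 0" for p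
      using r[of p] t(1)[of p] by (simp add: field_simps power2_eq_square)
    moreover have "p \<noteq> nxt p" for p
    proof -
      have "Suc (w p) = n \<or> Suc (w p) < n" using w_less[of p] by linarith
      then have "nx (w p) \<noteq> w p" using n_ge_3 by (auto simp: nx_Suc nx_last)
      then show ?thesis unfolding nxt_def by (metis w_v nx_less)
    qed
    ultimately show ?thesis by (simp add: cov_coords_def edge_coords_def mat_def vec_eq_iff)
  qed
  moreover have "(edge_coords \<longlongrightarrow> edge_coords (mat 1)) (nhds (mat 1))"
    unfolding edge_coords_def
    by (intro tendsto_Pair vec_tendstoI) (auto intro!: tendsto_intros filterlim_ident)
  ultimately have "\<forall>\<^sub>F S in nhds (mat 1). edge_coords S \<in> interior (cov_coords ` T)"
    by (intro topological_tendstoD) auto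
  then show ?thesis
  proof eventually_elim
    case (elim S)
    then obtain d t' where dt: "(d, t') \<in> T" "edge_coords S = cov_coords (d, t')"
      using interior_subset by fastforce
    show ?case
    proof
      assume "S \<in> sym_mats"
      with dt have "cov_mat d t' \<in> ml_fibre E S"
        by (intro cov_mat_in_fibre) (auto simp: T_def)
      then show "\<exists>X\<in>ml_fibre E S. dist X (cov_mat (\<chi> p. 1) t) < e"
        using dt(1) by (auto simp: T_def)
    qed
  qed
qed


text \<open>
  If all prescribed edge entries vanish, then \<open>(t $ p)\<^sup>2 = - rho t\<close> for all \<open>p\<close>, so the \<open>t $ p\<close> agree up
  to signs with some \<open>T\<close>, where \<open>rho t = - T\<^sup>2\<close>; as \<open>rho t\<close> is the product of the \<open>t $ p\<close>, the product of
  the signs times \<open>T ^ (n - 2)\<close> is \<open>-1\<close>. Negating \<open>T\<close> and all signs does not change \<open>t\<close>, and \<open>t\<close> and its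
  entrywise inverse give the same covariance matrix. This leaves \<open>T = exp (i pi k / (n - 2))\<close> with
  \<open>0 < k < n - 2\<close> and sign 1 at vertex 0; the sign at vertex \<open>n - 1\<close> is determined by the others.
\<close>

definition sgn_at :: "nat \<Rightarrow> nat set \<Rightarrow> nat \<Rightarrow> complex" where
  "sgn_at k A i = (if Suc i = n then (-1) ^ Suc k * (\<Prod>j<n - 1. if j \<in> A then -1 else 1)
    else if i \<in> A then -1 else 1)"

definition tau :: "nat \<Rightarrow> complex" where
  "tau k = cis (pi * k / (n - 2))"

definition branch :: "nat \<times> nat set \<Rightarrow> complex ^ 'n" where
  "branch kA = (\<chi> p. sgn_at (fst kA) (snd kA) (w p) * tau (fst kA))"

definition branches :: "(nat \<times> nat set) set" where
  "branches = {1..n - 3} \<times> Pow {1..n - 2}"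

lemma card_branches: "card branches = (n - 3) * 2 ^ (n - 2)"
  by (simp add: branches_def card_cartesian_product card_Pow)

lemma finite_branches: "finite branches"
  by (simp add: branches_def)

lemma prod_sgn_sq: "(\<Prod>j\<in>J. if j \<in> A then -1 else 1 :: complex)\<^sup>2 = 1"
  unfolding prod_power_distrib by (rule prod.neutral) auto

lemma sgn_at_sq: "(sgn_at k A i)\<^sup>2 = 1"
proof -
  have "((-1 :: complex) ^ Suc k)\<^sup>2 = 1"
    by (metis power_mult power_mult_distrib mult.commute power2_minus one_power2 power_one)
  then show ?thesis
    unfolding sgn_at_def by (simp add: power_mult_distrib prod_sgn_sq del: power_Suc)
qed

lemma sgn_at_nonzero: "sgn_at k A i \<noteq> 0"
  using sgn_at_sq[of k A i] by auto

lemma tau_nonzero: "tau k \<noteq> 0"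
  by (simp add: tau_def)

lemma tau_power: "tau k ^ (n - 2) = (-1) ^ k"
proof -
  have "real (n - 2) \<noteq> 0" using n_ge_3 by simp
  then have *: "real (n - 2) * (pi * k / real (n - 2)) = k * pi" by (simp add: field_simps)
  have "tau k ^ (n - 2) = cis (real k * pi)" unfolding tau_def Complex.DeMoivre * ..
  also have "\<dots> = cis pi ^ k" unfolding Complex.DeMoivre ..
  finally show ?thesis by simp
qed

lemma angle_bounds:
  assumes "k \<in> {1..n - 3}"
  shows "0 < pi * k / real (n - 2)" "pi * k / real (n - 2) < pi"
proof -
  define m where "m = real (n - 2)"
  have k: "0 < k" "k < n - 2" using assms n_ge_3 by auto
  then have m: "0 < m" "real k < m" unfolding m_def of_nat_less_iff by simp_all
  show "0 < pi * k / real (n - 2)" "pi * k / real (n - 2) < pi"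
    unfolding m_def[symmetric] using k(1) m by (simp_all add: pos_divide_less_eq)
qed

text \<open>The bounds on k place \<open>tau k\<close> strictly in the upper half plane. As
  \<open>rho\<close> of a branch is minus the square of \<open>tau k\<close>, this is the condition
  1 + rho \<noteq> 0.\<close>

lemma tau_sq_neq_1:
  assumes "k \<in> {1..n - 3}"
  shows "(tau k)\<^sup>2 \<noteq> 1"
proof
  assume "(tau k)\<^sup>2 = 1"
  then have "tau k = 1 \<or> tau k = -1" by (simp add: power2_eq_1_iff)
  then have "Im (tau k) = 0" by auto
  then show False using sin_gt_zero[OF angle_bounds[OF assms]] by (simp add: tau_def)
qed

lemma branch_sq: "(branch (k, A) $ p)\<^sup>2 = (tau k)\<^sup>2"
  by (simp add: branch_def power_mult_distrib sgn_at_sq)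

text \<open>The sign at the last position makes the product of all signs (-1) ^ (k + 1), while
  \<open>tau k ^ (n - 2)\<close> is (-1) ^ k; two factors \<open>tau k\<close> remain.\<close>

lemma rho_branch: "rho (branch (k, A)) = - (tau k)\<^sup>2"
proof -
  have nn: "n = Suc (n - 1)" using n_ge_3 by simp
  let ?P = "\<Prod>j<n - 1. if j \<in> A then -1 else (1 :: complex)"
  have "rho (branch (k, A)) = (\<Prod>i<n. sgn_at k A i * tau k)"
    unfolding z_n[symmetric] z_def by (rule prod.cong) (simp_all add: branch_def)
  also have "\<dots> = (\<Prod>i<n. sgn_at k A i) * tau k ^ n" by (simp add: prod.distrib)
  also have "(\<Prod>i<n. sgn_at k A i) = (\<Prod>i<n - 1. sgn_at k A i) * sgn_at k A (n - 1)"
    by (subst nn) (simp only: prod.lessThan_Suc)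
  also have "(\<Prod>i<n - 1. sgn_at k A i) = ?P"
    by (rule prod.cong) (auto simp: sgn_at_def)
  also have "sgn_at k A (n - 1) = (-1) ^ Suc k * ?P" using nn by (simp add: sgn_at_def)
  also have "?P * ((-1) ^ Suc k * ?P) = (-1) ^ Suc k"
  proof -
    have "x * (c * x) = c * x\<^sup>2" for x c :: complex by (simp add: power2_eq_square)
    then show ?thesis by (simp only: prod_sgn_sq mult_1_right)
  qed
  also have "tau k ^ n = (-1) ^ k * (tau k)\<^sup>2"
  proof -
    have "n = (n - 2) + 2" using n_ge_3 by simp
    then have "tau k ^ n = tau k ^ ((n - 2) + 2)" by (rule arg_cong)
    then show ?thesis unfolding power_add tau_power .
  qed
  also have "(-1) ^ Suc k * ((-1) ^ k * (tau k)\<^sup>2) = - (tau k)\<^sup>2"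
    by (simp flip: mult.assoc power_mult_distrib)
  finally show ?thesis .
qed

lemma branch_nonzero: "branch (k, A) $ p \<noteq> 0"
  by (simp add: branch_def sgn_at_nonzero tau_nonzero)

section \<open>Distinctness of the limit points\<close>

definition limit_point :: "nat \<times> nat set \<Rightarrow> complex ^ 'n ^ 'n" where
  "limit_point kA = cov_mat (\<chi> p. 1) (branch kA)"

text \<open>Entries at distance two reveal the product of consecutive signs and nothing else about
  k. Being nonzero, they also separate the limit points from the identity.\<close>

lemma limit_point_2:
  assumes "k \<in> {1..n - 3}" "i + 2 < n"
  shows "limit_point (k, A) $ v i $ v (i + 2) = - sgn_at k A i * sgn_at k A (Suc i)"
proof -
  let ?t = "branch (k, A)"
  define x e T where "x = z ?t i" and "e = sgn_at k A i * sgn_at k A (Suc i)" and "T = (tau k)\<^sup>2"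
  have x: "x \<noteq> 0" unfolding x_def by (rule z_nonzero[OF branch_nonzero])
  have "e\<^sup>2 = 1" by (simp add: e_def power_mult_distrib sgn_at_sq)
  then have e: "e * e = 1" by (simp only: power2_eq_square)
  then have e0: "e \<noteq> 0" by auto
  have inv_e: "1 / e = e" using e e0 by (simp add: field_simps)
  have T: "T \<noteq> 0" "1 - T \<noteq> 0" using tau_nonzero tau_sq_neq_1[OF assms(1)] by (auto simp: T_def)
  have z2: "z ?t (i + 2) = x * (e * T)"
    using assms(2) by (simp add: z_Suc x_def e_def T_def branch_def numeral_2_eq_2 power2_eq_square ac_simps)
  have "limit_point (k, A) $ v i $ v (i + 2) = cov ?t i (i + 2)"
    using assms(2) by (simp add: limit_point_def cov_mat_def)
  also have "\<dots> = (z ?t (i + 2) / z ?t i + rho ?t * z ?t i / z ?t (i + 2)) / (1 + rho ?t)"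
    by (rule cov_le) simp
  also have "\<dots> = (e * T + - T / (e * T)) / (1 + - T)"
    unfolding rho_branch T_def[symmetric] z2 x_def[symmetric] using x by simp
  also have "- T / (e * T) = - e" using T inv_e by (simp add: field_simps)
  also have "(e * T + - e) / (1 + - T) = - e" using T(2) by (simp add: field_simps)
  finally show ?thesis by (simp add: e_def)
qed

text \<open>An entry at distance three sees \<open>tau k\<close> through its sum with its inverse, a
  quantity invariant under t -> 1/t that still determines k.\<close>

lemma limit_point_3:
  assumes "k \<in> {1..n - 3}" "3 < n"
  shows "limit_point (k, A) $ v 0 $ v 3 =
    - sgn_at k A 0 * sgn_at k A 1 * sgn_at k A 2 * of_real (2 * cos (pi * k / (n - 2)))"
proof -
  let ?t = "branch (k, A)"
  define e T where "e = sgn_at k A 0 * sgn_at k A 1 * sgn_at k A 2" and "T = tau k"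
  have "e\<^sup>2 = 1" by (simp add: e_def power_mult_distrib sgn_at_sq)
  then have e: "e * e = 1" by (simp only: power2_eq_square)
  then have e0: "e \<noteq> 0" by auto
  have inv_e: "1 / e = e" using e e0 by (simp add: field_simps)
  have T: "T \<noteq> 0" "1 - T\<^sup>2 \<noteq> 0" using tau_nonzero tau_sq_neq_1[OF assms(1)] by (auto simp: T_def)
  have z3: "z ?t 3 = e * T ^ 3"
    using assms(2) by (simp add: z_Suc e_def T_def branch_def numeral_3_eq_3 numeral_2_eq_2 ac_simps)
  have "limit_point (k, A) $ v 0 $ v 3 = cov ?t 0 3"
    using assms(2) by (simp add: limit_point_def cov_mat_def)
  also have "\<dots> = (z ?t 3 / z ?t 0 + rho ?t * z ?t 0 / z ?t 3) / (1 + rho ?t)"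
    by (rule cov_le) simp
  also have "\<dots> = (e * T ^ 3 + - T\<^sup>2 / (e * T ^ 3)) / (1 + - T\<^sup>2)"
    unfolding rho_branch T_def[symmetric] z3 by simp
  also have "- T\<^sup>2 / (e * T ^ 3) = - e / T"
  proof -
    have "- T\<^sup>2 / (e * T ^ 3) = - (1 / e) / T"
      using T(1) e0 by (simp add: field_simps power2_eq_square power3_eq_cube)
    then show ?thesis by (simp only: inv_e)
  qed
  also have "e * T ^ 3 + - e / T = - e * (T + 1 / T) * (1 + - T\<^sup>2)"
    using T(1) by (simp add: field_simps power2_eq_square power3_eq_cube)
  also have "- e * (T + 1 / T) * (1 + - T\<^sup>2) / (1 + - T\<^sup>2) = - e * (T + 1 / T)"
    using T(2) by simp
  also have "T + 1 / T = of_real (2 * cos (pi * k / (n - 2)))"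
    by (simp add: T_def tau_def cis_inverse complex_eq_iff flip: inverse_eq_divide)
  finally show ?thesis by (simp add: e_def)
qed

text \<open>The sign at position 0 is 1 because 0 is not in A. Products of consecutive signs then
  give all signs up to position n - 2, hence A. The cosine gives k, being injective between 0 and
  pi.\<close>

lemma inj_limit_point: "inj_on limit_point branches"
proof (rule inj_onI, clarify)
  fix k A k' A'
  assume "(k, A) \<in> branches" "(k', A') \<in> branches" and eq: "limit_point (k, A) = limit_point (k', A')"
  then have k: "k \<in> {1..n - 3}" "k' \<in> {1..n - 3}" and A: "A \<subseteq> {1..n - 2}" "A' \<subseteq> {1..n - 2}"
    by (auto simp: branches_def)
  have n: "3 < n" using k(1) unfolding atLeastAtMost_iff by arith
  have sgn: "sgn_at k A i = sgn_at k' A' i" if "i \<le> n - 2" for i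
    using that
  proof (induction i)
    case 0
    then show ?case using A n by (auto simp: sgn_at_def)
  next
    case (Suc i)
    then have "i + 2 < n" using n by arith
    then have "sgn_at k A i * sgn_at k A (Suc i) = sgn_at k' A' i * sgn_at k' A' (Suc i)"
      using limit_point_2[OF k(1), of i A] limit_point_2[OF k(2), of i A'] eq by simp
    with Suc show ?case using sgn_at_nonzero[of k A i] by simp
  qed
  have mem: "i \<in> A \<longleftrightarrow> i \<in> A'" if "i \<in> {1..n - 2}" for i
    using sgn[of i] that by (auto simp: sgn_at_def split: if_splits)
  then have AA: "A = A'" using A by blast
  have "complex_of_real (2 * cos (pi * k / (n - 2))) = of_real (2 * cos (pi * k' / (n - 2)))"
    using limit_point_3[OF k(1) n, of A] limit_point_3[OF k(2) n, of A'] eq sgn[of 0] sgn[of 1] sgn[of 2]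
      sgn_at_nonzero n by simp
  then have cos_eq: "cos (pi * k / (n - 2)) = cos (pi * k' / (n - 2))"
    unfolding of_real_eq_iff by simp
  note bounds = angle_bounds[OF k(1), THEN less_imp_le] angle_bounds[OF k(2), THEN less_imp_le]
  have "pi * k / (n - 2) = pi * k' / (n - 2)"
    by (rule cos_inj_pi[OF bounds cos_eq])
  moreover have "real (n - 2) \<noteq> 0" using n by simp
  ultimately have "real k = real k'" by (simp only: divide_cancel_right mult_cancel_left) simp
  then have "k = k'" by simp
  with AA show "k = k' \<and> A = A'" by simp
qed

lemma limit_point_neq_1:
  assumes "kA \<in> branches"
  shows "limit_point kA \<noteq> mat 1"
proof
  assume eq: "limit_point kA = mat 1"
  obtain k A where kA: "kA = (k, A)" by (cases kA)
  have k: "k \<in> {1..n - 3}" using assms by (auto simp: branches_def kA)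
  have v02: "v 0 \<noteq> v 2" using w_v[of 0] w_v[of 2] n_ge_3 by fastforce
  have "- sgn_at k A 0 * sgn_at k A (Suc 0) = limit_point kA $ v 0 $ v 2"
    using limit_point_2[OF k, of 0 A] n_ge_3 by (simp add: kA numeral_2_eq_2)
  also have "\<dots> = 0" using v02 by (simp add: eq mat_def)
  finally have "- sgn_at k A 0 * sgn_at k A (Suc 0) = 0" .
  then show False by (simp add: sgn_at_nonzero)
qed

text \<open>The summand 1 is the identity matrix; for n = 3 there are no branches and it is the only
  point.\<close>

lemma ml_degree_cycle_ge: "ml_degree E \<ge> 1 + (n - 3) * 2 ^ (n - 2)"
proof -
  let ?Q = "insert (mat 1) (limit_point ` branches)"
  have "mat 1 \<notin> limit_point ` branches" using limit_point_neq_1 by fastforce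
  then have "card ?Q = 1 + card branches"
    using finite_branches by (simp add: card_image[OF inj_limit_point])
  moreover have "card ?Q \<le> ml_degree E"
  proof (rule ml_degree_ge_limits)
    show "mat 1 \<in> sym_mats" using mat_1_graph_space graph_space_subset_sym by blast
    show "finite ?Q" using finite_branches by simp
    fix Y and e :: real assume Y: "Y \<in> ?Q" and e: "e > 0"
    from Y consider "Y = mat 1" | k A where "(k, A) \<in> branches" "Y = limit_point (k, A)" by auto
    then show "\<forall>\<^sub>F S in nhds (mat 1). S \<in> sym_mats \<longrightarrow> (\<exists>X\<in>ml_fibre E S. dist X Y < e)"
    proof cases
      case 1
      then show ?thesis using ml_fibre_near_1[OF e] by simp
    next
      case 2
      then have "k \<in> {1..n - 3}" by (simp add: branches_def)
      then show ?thesis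
        unfolding 2 limit_point_def
        using e by (intro ml_fibre_near_cov_mat branch_nonzero)
          (simp_all add: branch_sq rho_branch tau_sq_neq_1)
    qed
  qed
  ultimately show ?thesis by (simp add: card_branches)
qed

end

theorem theorem3p15:
  fixes n :: nat and E :: "'n::finite set set"
  assumes "CARD('n) = n" and "n \<ge> 3" and "is_cycle_graph E"
  shows "ml_degree E \<ge> 1 + (n - 3) * 2 ^ (n - 2)"
proof -
  obtain v :: "nat \<Rightarrow> 'n" where "bij_betw v {..<n} UNIV"
    "E = {{v i, v (Suc i mod n)} | i. i < n}"
    using assms(1,3) unfolding is_cycle_graph_def by blast
  with assms(2) interpret labelled_cycle n v E by unfold_locales
  show ?thesis by (rule ml_degree_cycle_ge)
qed

end
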